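(* Let $m,k$ be integers with $1\le k\le m-1$. Let $\mathbf S'_{2m,2k-1}$ denote the image of $\mathbf S_{2m,2k-1}$ under the relabelling of vertices $(1,2,3,4,\dots,2m-1,2m)\mapsto(2,1,4,3,\dots,2m,2m-1)$ (that is, the labels $i$ and $i+1$ are swapped for every odd $i$). Then $\mathbf S'_{2m,2k-1}$ is the complement complex of $\mathbf S_{2m,2m-2k-1}$. In particular, $\mathbf S_{2m,2k-1}$ is positively decorable for all $k$ and regular for $k\ge2$.
   Context: An $(n,d)$-complex is a finite set $\Gamma$ of subsets of $[n]=\{1,\dots,n\}$ of cardinality $d+1$, called facets. The complement complex of $\Gamma$ is the $(n,n-d-2)$-complex with facets $[n]\setminus\tau$, $\tau\in\Gamma$. The complex $\mathbf S_{2m,2k-1}$, for integers $1\le k<m$: put $n=2m$. Consider sequences $1\le i_1<i_2<\dots<i_k\le n$ with $i_{j+1}>i_j+1$ for all $1\le j<k$, and with $i_1>1$ if $i_k=n$. To such a sequence associate the set $\{i_1,i_1+1,i_2,i_2+1,\dots,i_k,i_k+1\}\subset[n]$ of cardinality $2k$, where $i_k+1$ is replaced by $1$ if $i_k=n$ (these sets are the facets of the boundary complex of the cyclic polytope $C(n,2k)$). The facets of $\mathbf S_{2m,2k-1}$ are the sets so obtained from the sequences such that for all $1\le j\le k-1$ either $i_j$ is odd or $i_{j+1}-i_j>2$, and such that either $i_1\ne2$ or $i_k\ne n$. Thus $\mathbf S_{2m,2k-1}$ is a $(2m,2k-1)$-complex. An $(n,d)$-complex $\Gamma$ is regular if it is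 isomorphic to a (perhaps non-proper) subcomplex of a regular triangulation of some point configuration in $\mathbb R^d$; a triangulation of a configuration $\mathcal A$ (a triangulation of $\mathrm{conv}(\mathcal A)$ with vertices in $\mathcal A$) is regular if there is a convex function on $\mathrm{conv}(\mathcal A)$ which is affine on each simplex but not affine on the union of two different facets. $\Gamma$ is positively decorable if there is a real $d\times n$ matrix $C$ such that for every facet $\tau\in\Gamma$ the $d\times(d+1)$ submatrix of $C$ formed by the columns indexed by $\tau$ is positively spanning. A $d\times(d+1)$ real matrix $M$ is positively spanning if all the values $(-1)^i\,\mathrm{minor}(M,i)$, $1\le i\le d+1$, are nonzero and have the same sign, where $\mathrm{minor}(M,i)$ is the determinant of $M$ with its $i$-th column removed. *)

theory Defs
  imports
    "HOL-Analysis.Polytope"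
    "Jordan_Normal_Form.Determinant"
    "Jordan_Normal_Form.DL_Submatrix"
begin

text \<open>The sets in an \<open>(n,d)\<close>-complex are its facets only, not all its simplices.\<close>

definition nd_complex :: "nat \<Rightarrow> nat \<Rightarrow> nat set set \<Rightarrow> bool" where
  "nd_complex n d \<Gamma> \<longleftrightarrow> finite \<Gamma> \<and> (\<forall>\<tau>\<in>\<Gamma>. \<tau> \<subseteq> {1..n} \<and> card \<tau> = d + 1)"

definition complement_complex :: "nat \<Rightarrow> nat set set \<Rightarrow> nat set set" where
  "complement_complex n \<Gamma> = (\<lambda>\<tau>. {1..n} - \<tau>) ` \<Gamma>"

definition relabel :: "(nat \<Rightarrow> 'b) \<Rightarrow> nat set set \<Rightarrow> 'b set set" where
  "relabel \<phi> \<Gamma> = (\<lambda>\<tau>. \<phi> ` \<tau>) ` \<Gamma>"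

definition swap_pairs :: "nat \<Rightarrow> nat" where
  "swap_pairs i = (if odd i then i + 1 else i - 1)"

text \<open>Sequences are functions of which only the values at \<open>1, \<dots>, k\<close> matter.\<close>

definition cyclic_seq :: "nat \<Rightarrow> nat \<Rightarrow> (nat \<Rightarrow> nat) \<Rightarrow> bool" where
  "cyclic_seq n k i \<longleftrightarrow>
     1 \<le> i 1 \<and> i k \<le> n \<and>
     (\<forall>j. 1 \<le> j \<and> j < k \<longrightarrow> i j + 1 < i (j + 1)) \<and>
     (i k = n \<longrightarrow> 1 < i 1)"

definition cyclic_facet :: "nat \<Rightarrow> nat \<Rightarrow> (nat \<Rightarrow> nat) \<Rightarrow> nat set" where
  "cyclic_facet n k i = (\<Union>j\<in>{1..k}. {i j, if i j = n then 1 else i j + 1})"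

text \<open>The complex \<open>S\<^bsub>n,d\<^esub>\<close>; it is meant for \<open>n = 2m\<close> and \<open>d = 2k - 1\<close> with \<open>1 \<le> k < m\<close>.\<close>

definition S_complex :: "nat \<Rightarrow> nat \<Rightarrow> nat set set" where
  "S_complex n d =
     {cyclic_facet n k i | k i. d + 1 = 2 * k \<and> cyclic_seq n k i \<and>
        (\<forall>j. 1 \<le> j \<and> j \<le> k - 1 \<longrightarrow> odd (i j) \<or> i (j + 1) - i j > 2) \<and>
        (i 1 \<noteq> 2 \<or> i k \<noteq> n)}"

definition vertices_of :: "'a::euclidean_space set \<Rightarrow> 'a set" where
  "vertices_of \<sigma> = {x. x extreme_point_of \<sigma>}"

text \<open>A triangulation of a point configuration \<open>A\<close> is given by its maximal simplices. Not every
  point of \<open>A\<close> has to be used as a vertex.\<close>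

definition triangulation_of :: "'a::euclidean_space set \<Rightarrow> 'a set set \<Rightarrow> bool" where
  "triangulation_of A \<T> \<longleftrightarrow>
     finite A \<and> triangulation \<T> \<and> \<Union>\<T> = convex hull A \<and>
     (\<forall>\<sigma>\<in>\<T>. (aff_dim A) simplex \<sigma> \<and> vertices_of \<sigma> \<subseteq> A)"

definition affine_fun_on :: "'a::euclidean_space set \<Rightarrow> ('a \<Rightarrow> real) \<Rightarrow> bool" where
  "affine_fun_on X f \<longleftrightarrow> (\<exists>g c. linear g \<and> (\<forall>x\<in>X. f x = g x + c))"

definition regular_triangulation_of :: "'a::euclidean_space set \<Rightarrow> 'a set set \<Rightarrow> bool" where
  "regular_triangulation_of A \<T> \<longleftrightarrow>
     triangulation_of A \<T> \<and>
     (\<exists>f. convex_on (convex hull A) f \<and>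
        (\<forall>\<sigma>\<in>\<T>. affine_fun_on \<sigma> f) \<and>
        (\<forall>\<sigma>\<in>\<T>. \<forall>\<tau>\<in>\<T>. \<sigma> \<noteq> \<tau> \<longrightarrow> \<not> affine_fun_on (\<sigma> \<union> \<tau>) f))"

text \<open>Here \<open>\<real>\<^sup>d\<close> is the Euclidean space \<open>'a\<close>, so that \<open>d = DIM('a)\<close>.\<close>

definition regular_complex :: "'a::euclidean_space itself \<Rightarrow> nat \<Rightarrow> nat set set \<Rightarrow> bool" where
  "regular_complex _ n \<Gamma> \<longleftrightarrow>
     nd_complex n DIM('a) \<Gamma> \<and>
     (\<exists>A \<T> (\<phi> :: nat \<Rightarrow> 'a).
        regular_triangulation_of A \<T> \<and> inj_on \<phi> (\<Union>\<Gamma>) \<and> relabel \<phi> \<Gamma> \<subseteq> vertices_of ` \<T>)"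

text \<open>Matrices are indexed from \<open>0\<close> in the library but columns are numbered from \<open>1\<close> here:
  \<open>column_minor M i\<close> deletes the column with library index \<open>i - 1\<close>.\<close>

definition column_minor :: "real mat \<Rightarrow> nat \<Rightarrow> real" where
  "column_minor M i = Determinant.det (submatrix M UNIV (- {i - 1}))"

definition positively_spanning :: "real mat \<Rightarrow> bool" where
  "positively_spanning M \<longleftrightarrow>
     dim_col M = dim_row M + 1 \<and>
     ((\<forall>i\<in>{1..dim_col M}. (-1) ^ i * column_minor M i > 0) \<or>
      (\<forall>i\<in>{1..dim_col M}. (-1) ^ i * column_minor M i < 0))"

definition positively_decorable :: "nat \<Rightarrow> nat \<Rightarrow> nat set set \<Rightarrow> bool" where
  "positively_decorable n d \<Gamma> \<longleftrightarrow>
     nd_complex n d \<Gamma> \<and>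
     (\<exists>C \<in> carrier_mat d n. \<forall>\<tau>\<in>\<Gamma>. positively_spanning (submatrix C UNIV {j. j + 1 \<in> \<tau>}))"

end

theory Submission
  imports Defs "HOL-Computational_Algebra.Polynomial"
begin

text \<open>Group the vertices into blocks \<open>{2j-1, 2j}\<close>. A set of \<open>2k\<close> vertices is a facet if and only if,
  cyclically, a block is met in its right vertex alone exactly when the next block is met in its
  left vertex alone. Complementation followed by swapping the vertices of each block preserves
  this condition.

  By Gale's evenness condition for the complement, the swapped image of a facet alternates in parity.
  Hence the Vandermonde matrix whose columns carry alternating signs (a Gale transform of a cyclic
  polytope) decorates the complex.

  For \<open>k \<ge> 2\<close> the complex is contained in the boundary of the cyclic polytope \<open>C(2m,2k)\<close> but
  misses one of its facets, so a projective image of the moment curve exhibits it inside the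
  lower hull of a generic lift, which is a regular triangulation.\<close>

section \<open>Facets as unions of dominoes\<close>

text \<open>The defining sequences cut the circle open at \<open>n\<close>, which hides the symmetry
  under complementation; so the order is dropped in favour of a cyclic condition on neighbouring
  blocks. Afterwards everything metric is done with polynomials: a hyperplane meets the moment curve
  in the zeros of a polynomial of bounded degree, so nonzero minors, general position and facet
  inequalities become counts of roots and of sign changes. Alternating parities decorate because the
  linear relation between d + 1 Vandermonde columns of height d has coefficients whose signs
  alternate along the increasing nodes; the signs (-1)^label undo this alternation. Regularity fails
  for k = 1 because the complex is then the whole boundary of the 2m-gon, a closed cycle of edges,
  which no triangulation of a segment contains. For k >= 2 the parity condition removes a facet, and
  this gap is the window through which the rest of the boundary is seen without overlaps.\<close>

definition cyc_suc :: "nat \<Rightarrow> nat \<Rightarrow> nat" where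
  "cyc_suc n i = (if i = n then 1 else i + 1)"

definition dominoes :: "nat \<Rightarrow> nat set \<Rightarrow> nat set" where
  "dominoes n I = (\<Union>i\<in>I. {i, cyc_suc n i})"

text \<open>For i = n the first condition is the clause that i_1 > 1 if i_k = n, and for even n the
  second is the clause excluding i_1 = 2 together with i_k = n. The wrap-around thus stops being a
  special case.\<close>

definition domino_starts :: "nat \<Rightarrow> nat set \<Rightarrow> bool" where
  "domino_starts n I \<longleftrightarrow> I \<subseteq> {1..n} \<and>
     (\<forall>i\<in>I. cyc_suc n i \<notin> I \<and> (even i \<longrightarrow> cyc_suc n (cyc_suc n i) \<notin> I))"

lemma cyc_suc_range: "i \<in> {1..n} \<Longrightarrow> cyc_suc n i \<in> {1..n}"
  by (cases "i = n") (simp_all add: cyc_suc_def)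

lemma cyc_suc_inj: "i \<in> {1..n} \<Longrightarrow> j \<in> {1..n} \<Longrightarrow> cyc_suc n i = cyc_suc n j \<Longrightarrow> i = j"
  by (cases "i = n"; cases "j = n") (simp_all add: cyc_suc_def)

lemma cyc_suc_parity: "even n \<Longrightarrow> i \<in> {1..n} \<Longrightarrow> even (cyc_suc n i) \<longleftrightarrow> odd i"
  by (cases "i = n") (simp_all add: cyc_suc_def)

lemma cyclic_facet_eq: "cyclic_facet n k s = dominoes n (s ` {1..k})"
  by (auto simp: cyclic_facet_def dominoes_def cyc_suc_def)

lemma cyclic_seq_less:
  assumes "cyclic_seq n k s" "1 \<le> a" "a < b" "b \<le> k"
  shows "s a + 1 < s b"
  using assms(3,4)
proof (induction b)
  case (Suc b)
  have "s b + 1 < s (Suc b)" using assms(1,2) Suc.prems by (simp add: cyclic_seq_def)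
  moreover have "s a \<le> s b"
    using Suc by (cases "a = b") simp_all
  ultimately show ?case by simp
qed simp

lemma cyclic_seq_range:
  assumes "cyclic_seq n k s" "j \<in> {1..k}"
  shows "s j \<in> {1..n}"
proof -
  have "s 1 \<le> s j"
    using cyclic_seq_less[OF assms(1), of 1 j] assms(2) by (cases "j = 1") auto
  moreover have "s j \<le> s k"
    using cyclic_seq_less[OF assms(1), of j k] assms(2) by (cases "j = k") auto
  ultimately show ?thesis using assms(1) by (simp add: cyclic_seq_def)
qed

section \<open>From sequences to cyclic sets of starts\<close>

lemma S_complex_facetE:
  assumes "\<tau> \<in> S_complex (2 * m) (2 * k - 1)" "1 \<le> k" "2 \<le> m"
  obtains I where "domino_starts (2 * m) I" "card I = k" "\<tau> = dominoes (2 * m) I"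
proof -
  let ?n = "2 * m"
  obtain s where s: "cyclic_seq ?n k s"
    and gap: "\<And>j. 1 \<le> j \<Longrightarrow> j \<le> k - 1 \<Longrightarrow> odd (s j) \<or> s (j + 1) - s j > 2"
    and wrap: "s 1 \<noteq> 2 \<or> s k \<noteq> ?n" and \<tau>: "\<tau> = cyclic_facet ?n k s"
  proof -
    have "k' = k" if "2 * k - 1 + 1 = 2 * k'" for k' using that assms(2) by simp
    then show ?thesis using assms(1) that by (auto simp: S_complex_def)
  qed
  have less: "s a + 1 < s b" if "1 \<le> a" "a < b" "b \<le> k" for a b
    using cyclic_seq_less[OF s that] .
  have range: "s j \<in> {1..?n}" if "j \<in> {1..k}" for j using cyclic_seq_range[OF s that] .
  \<comment> \<open>The extra gap is demanded only between consecutive terms; across two steps the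
    distance is at least 4 anyway.\<close>
  have gap2: "s a + 2 < s b" if "1 \<le> a" "a < b" "b \<le> k" "even (s a)" for a b
  proof (cases "b = a + 1")
    case True
    then have "odd (s a) \<or> s (a + 1) - s a > 2" using gap[of a] that by simp
    then show ?thesis using that(4) True by simp
  next
    case False
    then show ?thesis using less[of a "a + 1"] less[of "a + 1" b] that by auto
  qed
  have first: "s 1 \<le> s j" if "j \<in> {1..k}" for j
    using less[of 1 j] that by (cases "j = 1") auto
  have last: "s j \<le> s k" if "j \<in> {1..k}" for j
    using less[of j k] that by (cases "j = k") auto
  have no_suc: "s b \<noteq> cyc_suc ?n (s a)" if ab: "a \<in> {1..k}" "b \<in> {1..k}" for a b
  proof (cases "s a = ?n")
    case True
    then have "s k = ?n" using last[OF ab(1)] range[of k] assms(2) by force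
    then have "1 < s 1" using s by (simp add: cyclic_seq_def)
    then show ?thesis using True first[OF ab(2)] by (simp add: cyc_suc_def)
  next
    case False
    then show ?thesis
      using less[of a b] less[of b a] ab by (cases a b rule: linorder_cases) (auto simp: cyc_suc_def)
  qed
  have no_suc2: "s b \<noteq> cyc_suc ?n (cyc_suc ?n (s a))"
    if ab: "a \<in> {1..k}" "b \<in> {1..k}" "even (s a)" for a b
  proof (cases "s a = ?n")
    case True
    then have k: "s k = ?n" using last[OF ab(1)] range[of k] assms(2) by force
    then have "1 < s 1" using s by (simp add: cyclic_seq_def)
    then have "s 1 > 2" using wrap k by simp
    then show ?thesis using True first[OF ab(2)] assms(3) by (simp add: cyc_suc_def)
  next
    case False
    then have "s a + 1 \<noteq> ?n" using ab(3) by (metis even_mult_iff even_plus_one_iff even_numeral)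
    then have "cyc_suc ?n (cyc_suc ?n (s a)) = s a + 2" using False by (simp add: cyc_suc_def)
    then show ?thesis
      using gap2[of a b] less[of b a] ab by (cases a b rule: linorder_cases) auto
  qed
  have "inj_on s {1..k}"
    by (rule linorder_inj_onI) (use less in force)+
  then have "card (s ` {1..k}) = k" by (simp add: card_image)
  moreover have "domino_starts ?n (s ` {1..k})"
    unfolding domino_starts_def using range no_suc no_suc2 by (fastforce simp: image_iff)
  ultimately show ?thesis using that \<tau> cyclic_facet_eq by metis
qed

lemma S_complex_facetI:
  assumes I: "domino_starts (2 * m) I" "card I = k" and k: "1 \<le> k" and m: "2 \<le> m"
  shows "dominoes (2 * m) I \<in> S_complex (2 * m) (2 * k - 1)"
proof -
  let ?n = "2 * m"
  have fin: "finite I" using I(1) by (auto simp: domino_starts_def intro: finite_subset)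
  define xs where "xs = sorted_list_of_set I"
  have len: "length xs = k" using I(2) by (simp add: xs_def)
  have set: "set xs = I" using fin by (simp add: xs_def)
  define s where "s j = xs ! (j - 1)" for j
  have mem: "s j \<in> I" if "1 \<le> j" "j \<le> k" for j
    unfolding s_def set[symmetric] using that len by (intro nth_mem) auto
  have lt: "s a < s b" if "1 \<le> a" "a < b" "b \<le> k" for a b
    unfolding s_def xs_def using that len
    by (intro sorted_wrt_nth_less[OF strict_sorted_list_of_set]) (auto simp: xs_def)
  have img: "s ` {1..k} = I"
  proof
    show "s ` {1..k} \<subseteq> I" using mem by auto
    show "I \<subseteq> s ` {1..k}"
    proof
      fix x assume "x \<in> I"
      then obtain j where "j < length xs" "xs ! j = x" using set by (metis in_set_conv_nth)
      then show "x \<in> s ` {1..k}" using len by (intro image_eqI[of _ _ "j + 1"]) (auto simp: s_def)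
    qed
  qed
  have range: "i \<in> {1..?n}" and suc: "cyc_suc ?n i \<notin> I"
    and suc2: "even i \<Longrightarrow> cyc_suc ?n (cyc_suc ?n i) \<notin> I" if "i \<in> I" for i
    using I(1) that by (auto simp: domino_starts_def)
  have step: "s j + 1 < s (j + 1)" if "1 \<le> j" "j < k" for j
  proof -
    have "s j < s (j + 1)" "s j \<in> I" "s (j + 1) \<in> I" using lt mem that by auto
    moreover from this have "s j \<noteq> ?n" using range[of "s (j + 1)"] by auto
    ultimately show ?thesis using suc[of "s j"] by (cases "s j + 1 = s (j + 1)") (auto simp: cyc_suc_def)
  qed
  have "cyclic_seq ?n k s"
    unfolding cyclic_seq_def
  proof (intro conjI allI impI)
    show "1 \<le> s 1" "s k \<le> ?n" using range[OF mem[of 1]] range[OF mem[of k]] k by auto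
    show "s j + 1 < s (j + 1)" if "1 \<le> j \<and> j < k" for j using step that by simp
    assume "s k = ?n"
    then have "s 1 \<noteq> 1" using suc[OF mem[of k]] mem[of 1] k by (auto simp: cyc_suc_def)
    then show "1 < s 1" using \<open>1 \<le> s 1\<close> by simp
  qed
  moreover have "odd (s j) \<or> s (j + 1) - s j > 2" if j: "1 \<le> j" "j \<le> k - 1" for j
  proof (rule ccontr)
    assume "\<not> ?thesis"
    then have ev: "even (s j)" and "s (j + 1) - s j \<le> 2" by auto
    moreover have "s j + 1 < s (j + 1)" using step[of j] j k by simp
    ultimately have "s (j + 1) = s j + 2" by linarith
    moreover have "s j \<in> I" "s (j + 1) \<in> I" using mem j by auto
    moreover have "s j + 1 < ?n" using range[of "s (j + 1)"] calculation by auto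
    ultimately show False using suc2[of "s j"] ev by (simp add: cyc_suc_def)
  qed
  moreover have "s 1 \<noteq> 2 \<or> s k \<noteq> ?n"
  proof -
    have "cyc_suc ?n (cyc_suc ?n ?n) = 2" using m by (simp add: cyc_suc_def)
    then show ?thesis using suc2[OF mem[of k]] mem[of 1] k by (metis dvd_triv_left order_refl)
  qed
  moreover have "2 * k - 1 + 1 = 2 * k" using k by simp
  ultimately have "cyclic_facet ?n k s \<in> S_complex ?n (2 * k - 1)"
    unfolding S_complex_def by blast
  then show ?thesis unfolding cyclic_facet_eq img .
qed

text \<open>The vertices come in blocks \<open>{2j-1, 2j}\<close>; a block meets a facet in a single vertex exactly
  when a domino starting at an even vertex bridges it to a neighbouring block.\<close>

definition bridged :: "nat \<Rightarrow> nat set \<Rightarrow> bool" where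
  "bridged n \<tau> \<longleftrightarrow> (\<forall>e\<in>{1..n}. even e \<longrightarrow>
     (e \<in> \<tau> \<and> e - 1 \<notin> \<tau> \<longleftrightarrow> cyc_suc n e \<in> \<tau> \<and> cyc_suc n e + 1 \<notin> \<tau>))"

section \<open>The block condition characterizes the facets\<close>

lemma card_dominoes:
  assumes "I \<subseteq> {1..n}" "\<And>i. i \<in> I \<Longrightarrow> cyc_suc n i \<notin> I"
  shows "card (dominoes n I) = 2 * card I"
proof -
  have fin: "finite I" using assms(1) finite_subset by blast
  have "dominoes n I = I \<union> cyc_suc n ` I" by (auto simp: dominoes_def)
  moreover have "card (cyc_suc n ` I) = card I"
    using assms(1) cyc_suc_inj by (intro card_image inj_onI) blast
  moreover have "I \<inter> cyc_suc n ` I = {}" using assms(2) by auto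
  ultimately show ?thesis using fin by (simp add: card_Un_disjoint)
qed

text \<open>Both sides of the condition at \<open>e\<close> are equivalent to
  \<open>e \<in> I\<close>: an odd start covers its whole block, so a half-covered block comes from
  an even start, and the gap after even starts keeps the other half of that block uncovered.\<close>

lemma bridged_dominoes:
  assumes I: "domino_starts n I" and n: "even n"
  shows "bridged n (dominoes n I)"
  unfolding bridged_def
proof (intro ballI impI)
  fix e assume e: "e \<in> {1..n}" "even e"
  have e2: "e - 1 \<in> {1..n}" "cyc_suc n (e - 1) = e" using e by (auto simp: cyc_suc_def)
  have o: "cyc_suc n e \<in> {1..n}" "odd (cyc_suc n e)" 
    using cyc_suc_range cyc_suc_parity e n by auto
  have o2: "cyc_suc n e + 1 = cyc_suc n (cyc_suc n e)"
    using o n by (auto simp: cyc_suc_def)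
  have mem: "cyc_suc n x \<in> dominoes n I \<longleftrightarrow> cyc_suc n x \<in> I \<or> x \<in> I" if "x \<in> {1..n}" for x
  proof -
    have "I \<subseteq> {1..n}" using I by (simp add: domino_starts_def)
    then have "cyc_suc n x = cyc_suc n i \<Longrightarrow> i \<in> I \<Longrightarrow> x = i" for i using cyc_suc_inj[OF that] by blast
    then show ?thesis unfolding dominoes_def by blast
  qed
  have sub: "x \<in> I \<Longrightarrow> x \<in> dominoes n I \<and> cyc_suc n x \<in> dominoes n I" for x
    by (auto simp: dominoes_def)
  have not: "x \<in> I \<Longrightarrow> cyc_suc n x \<notin> I" "x \<in> I \<Longrightarrow> even x \<Longrightarrow> cyc_suc n (cyc_suc n x) \<notin> I" for x
    using I by (auto simp: domino_starts_def)
  have pred: "e - 1 \<notin> dominoes n I" if "e \<in> I"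
  proof
    assume "e - 1 \<in> dominoes n I"
    then consider "e - 1 \<in> I" | i where "i \<in> I" "cyc_suc n i = e - 1" by (auto simp: dominoes_def)
    then show False
    proof cases
      case 1 then show False using not(1) e2(2) that by metis
    next
      case 2
      then have "i \<in> {1..n}" using I by (auto simp: domino_starts_def)
      then have "even i" using cyc_suc_parity[OF n, of i] 2 e e2 by auto
      then show False using not(2)[of i] 2 e2(2) that by simp
    qed
  qed
  have "e \<in> dominoes n I \<and> e - 1 \<notin> dominoes n I \<longleftrightarrow> e \<in> I"
    using mem[OF e2(1)] sub[of "e - 1"] sub[of e] pred e2(2) by auto
  moreover have "cyc_suc n e \<in> dominoes n I \<and> cyc_suc n e + 1 \<notin> dominoes n I \<longleftrightarrow> e \<in> I"
    unfolding o2 using mem[OF e(1)] mem[OF o(1)] sub[of "cyc_suc n e"] sub[of e] not[of e] e(2) by auto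
  ultimately show "e \<in> dominoes n I \<and> e - 1 \<notin> dominoes n I \<longleftrightarrow>
      cyc_suc n e \<in> dominoes n I \<and> cyc_suc n e + 1 \<notin> dominoes n I" by simp
qed

lemma bridged_imp_dominoes:
  assumes \<tau>: "bridged n \<tau>" "\<tau> \<subseteq> {1..n}" and n: "even n"
  obtains I where "domino_starts n I" "\<tau> = dominoes n I"
proof -
  \<comment> \<open>The dominoes are read off from the blocks: a full block is a domino with odd
    start, and a block met in its right vertex alone starts a bridge.\<close>
  define I where "I = {i \<in> \<tau>. if odd i then i + 1 \<in> \<tau> else i - 1 \<notin> \<tau>}"
  have br: "e \<in> \<tau> \<and> e - 1 \<notin> \<tau> \<longleftrightarrow> cyc_suc n e \<in> \<tau> \<and> cyc_suc n e + 1 \<notin> \<tau>" if "e \<in> {1..n}" "even e" for e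
    using \<tau>(1) that by (auto simp: bridged_def)
  have odd_suc: "cyc_suc n i = i + 1" if "odd i" for i using that n by (auto simp: cyc_suc_def)
  have starts: "domino_starts n I"
    unfolding domino_starts_def
  proof (intro conjI ballI impI)
    show "I \<subseteq> {1..n}" using \<tau>(2) by (auto simp: I_def)
    fix i assume i: "i \<in> I"
    then have r: "i \<in> {1..n}" using \<tau>(2) by (auto simp: I_def)
    show "cyc_suc n i \<notin> I"
    proof (cases "odd i")
      case True
      then show ?thesis using i odd_suc[OF True] by (simp add: I_def)
    next
      case False
      then have "odd (cyc_suc n i)" using cyc_suc_parity[OF n r] by simp
      then show ?thesis using br[OF r] i False by (simp add: I_def)
    qed
    assume ev: "even i"
    have o: "odd (cyc_suc n i)" using cyc_suc_parity[OF n r] ev by simp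
    show "cyc_suc n (cyc_suc n i) \<notin> I"
      unfolding odd_suc[OF o] using br[OF r ev] i ev o by (simp add: I_def)
  qed
  have "\<tau> = dominoes n I"
  proof
    show "dominoes n I \<subseteq> \<tau>"
    proof
      fix x assume "x \<in> dominoes n I"
      then obtain i where i: "i \<in> I" "x = i \<or> x = cyc_suc n i" by (auto simp: dominoes_def)
      then have r: "i \<in> {1..n}" using \<tau>(2) by (auto simp: I_def)
      show "x \<in> \<tau>"
        using i br[OF r] odd_suc[of i] by (cases "odd i") (auto simp: I_def)
    qed
    show "\<tau> \<subseteq> dominoes n I"
    proof
      fix x assume x: "x \<in> \<tau>"
      then have r: "x \<in> {1..n}" using \<tau>(2) by auto
      show "x \<in> dominoes n I"
      proof (cases "x \<in> I")
        case True then show ?thesis by (auto simp: dominoes_def)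
      next
        case False
        \<comment> \<open>The cyclic predecessor of \<open>x\<close>: as \<open>x\<close> is not a
          start, it must be the second vertex of the domino at \<open>e\<close>.\<close>
        define e where "e = (if x = 1 then n else x - 1)"
        have e: "e \<in> {1..n}" "cyc_suc n e = x" using r by (auto simp: e_def cyc_suc_def)
        have "e \<in> I"
        proof (cases "odd x")
          case True
          then have "x + 1 \<notin> \<tau>" using False x by (simp add: I_def)
          moreover have "even e" using cyc_suc_parity[OF n e(1)] e(2) True by simp
          ultimately show ?thesis using br[OF e(1)] e(2) x by (simp add: I_def)
        next
          case ev: False
          then have "x - 1 \<in> \<tau>" "x \<noteq> 1" using False x by (auto simp: I_def)
          then show ?thesis using ev x r by (auto simp: I_def e_def)
        qed
        then show ?thesis using e(2) by (force simp: dominoes_def)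
      qed
    qed
  qed
  then show ?thesis using that starts by blast
qed

text \<open>Neither sequences nor starts occur on the right, so complementation can be checked block
  by block.\<close>

theorem S_complex_iff:
  assumes "1 \<le> k" "2 \<le> m"
  shows "\<tau> \<in> S_complex (2 * m) (2 * k - 1) \<longleftrightarrow>
    \<tau> \<subseteq> {1..2 * m} \<and> card \<tau> = 2 * k \<and> bridged (2 * m) \<tau>"
proof
  assume "\<tau> \<in> S_complex (2 * m) (2 * k - 1)"
  then obtain I where I: "domino_starts (2 * m) I" "card I = k" "\<tau> = dominoes (2 * m) I"
    using S_complex_facetE assms by metis
  have "\<tau> \<subseteq> {1..2 * m}"
    using I(1,3) cyc_suc_range[of _ "2 * m"] unfolding dominoes_def domino_starts_def by blast
  moreover have "card \<tau> = 2 * k"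
    using I card_dominoes[of I "2 * m"] by (simp add: domino_starts_def)
  ultimately show "\<tau> \<subseteq> {1..2 * m} \<and> card \<tau> = 2 * k \<and> bridged (2 * m) \<tau>"
    using bridged_dominoes I by simp
next
  assume \<tau>: "\<tau> \<subseteq> {1..2 * m} \<and> card \<tau> = 2 * k \<and> bridged (2 * m) \<tau>"
  then obtain I where I: "domino_starts (2 * m) I" "\<tau> = dominoes (2 * m) I"
    using bridged_imp_dominoes[of "2 * m" \<tau>] by auto
  then have "card I = k" using \<tau> card_dominoes[of I "2 * m"] by (simp add: domino_starts_def)
  then show "\<tau> \<in> S_complex (2 * m) (2 * k - 1)" using S_complex_facetI I assms by simp
qed

text \<open>A domino with one vertex strictly between two missing vertices lies there entirely: it
  cannot contain \<open>a\<close> or \<open>b\<close>, and the domino {n, 1} has no vertex strictly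
  between them. So the intersection is a union of whole dominoes.\<close>

lemma S_complex_gale_evenness:
  assumes \<tau>: "\<tau> \<in> S_complex (2 * m) (2 * k - 1)" and km: "1 \<le> k" "2 \<le> m"
    and a: "a \<in> {1..2 * m} - \<tau>" and b: "b \<in> {1..2 * m} - \<tau>"
  shows "even (card (\<tau> \<inter> {a<..<b}))"
proof -
  let ?n = "2 * m"
  obtain I where I: "domino_starts ?n I" "\<tau> = dominoes ?n I"
    using S_complex_facetE[OF \<tau> km] by metis
  define J where "J = I \<inter> {a<..<b}"
  have "x \<in> \<tau> \<inter> {a<..<b} \<longleftrightarrow> x \<in> dominoes ?n J" for x
  proof
    assume x: "x \<in> \<tau> \<inter> {a<..<b}"
    then obtain i where i: "i \<in> I" "x = i \<or> x = cyc_suc ?n i" using I(2) by (auto simp: dominoes_def)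
    have "i \<in> \<tau>" using i(1) I(2) by (auto simp: dominoes_def)
    then have "i \<noteq> a" using a by auto
    then have "i \<in> J" using i x a b by (auto simp: J_def cyc_suc_def split: if_splits)
    then show "x \<in> dominoes ?n J" using i(2) by (auto simp: dominoes_def)
  next
    assume "x \<in> dominoes ?n J"
    then obtain i where i: "i \<in> I" "a < i" "i < b" "x = i \<or> x = cyc_suc ?n i"
      by (auto simp: dominoes_def J_def)
    have "x \<in> \<tau>" using i(1,4) I(2) by (auto simp: dominoes_def)
    moreover from this have "x \<noteq> b" using b by auto
    moreover have "cyc_suc ?n i = i + 1" using i(3) b by (auto simp: cyc_suc_def)
    ultimately show "x \<in> \<tau> \<inter> {a<..<b}" using i(2,3,4) by auto
  qed
  then have "\<tau> \<inter> {a<..<b} = dominoes ?n J" by blast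
  moreover have "card (dominoes ?n J) = 2 * card J"
    using I(1) by (intro card_dominoes) (auto simp: J_def domino_starts_def)
  ultimately show ?thesis by simp
qed

section \<open>Complementation and the swap of paired vertices\<close>

lemma swap_pairs_swap_pairs: "1 \<le> i \<Longrightarrow> swap_pairs (swap_pairs i) = i"
  by (auto simp: swap_pairs_def)

lemma swap_pairs_range:
  assumes "i \<in> {1..2 * m}"
  shows "swap_pairs i \<in> {1..2 * m}"
proof (cases "odd i")
  case True
  then have "i \<noteq> 2 * m" by auto
  then show ?thesis using assms True by (simp add: swap_pairs_def)
next
  case False
  then have "2 \<le> i" using assms by (cases "i = 1") auto
  then show ?thesis using assms False by (auto simp: swap_pairs_def)
qed

lemma bij_betw_swap_pairs: "bij_betw swap_pairs {1..2 * m} {1..2 * m}"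
proof (rule bij_betw_byWitness[where f' = swap_pairs])
  show "\<forall>i\<in>{1..2 * m}. swap_pairs (swap_pairs i) = i"
    using swap_pairs_swap_pairs by (meson atLeastAtMost_iff)
  then show "\<forall>i\<in>{1..2 * m}. swap_pairs (swap_pairs i) = i" .
  show "swap_pairs ` {1..2 * m} \<subseteq> {1..2 * m}" by (intro image_subsetI swap_pairs_range)
  then show "swap_pairs ` {1..2 * m} \<subseteq> {1..2 * m}" .
qed

lemma complement_swap_pairs_iff:
  assumes "\<tau> \<subseteq> {1..2 * m}" "x \<in> {1..2 * m}"
  shows "x \<in> {1..2 * m} - swap_pairs ` \<tau> \<longleftrightarrow> swap_pairs x \<notin> \<tau>"
proof -
  have "x \<in> swap_pairs ` \<tau> \<longleftrightarrow> swap_pairs x \<in> \<tau>"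
  proof
    assume "x \<in> swap_pairs ` \<tau>"
    then obtain y where "y \<in> \<tau>" "x = swap_pairs y" by blast
    then show "swap_pairs x \<in> \<tau>" using assms(1) swap_pairs_swap_pairs[of y] by force
  next
    assume "swap_pairs x \<in> \<tau>"
    then show "x \<in> swap_pairs ` \<tau>" using assms(2) swap_pairs_swap_pairs[of x] by force
  qed
  then show ?thesis using assms(2) by simp
qed

text \<open>A vertex lies in the new set exactly when its partner is missing from \<tau>. Hence
  "right vertex in, left vertex out" holds for a block of the new set iff it holds for that block of
  \<tau>, likewise with left and right exchanged, and \<open>bridged\<close> carries over
  literally.\<close>

lemma complement_swap_pairs_S_complex:
  assumes k: "1 \<le> k" "k < m" and \<tau>: "\<tau> \<in> S_complex (2 * m) (2 * k - 1)"
  shows "{1..2 * m} - swap_pairs ` \<tau> \<in> S_complex (2 * m) (2 * (m - k) - 1)"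
proof -
  let ?\<sigma> = "{1..2 * m} - swap_pairs ` \<tau>"
  have sub: "\<tau> \<subseteq> {1..2 * m}" and card: "card \<tau> = 2 * k" and br: "bridged (2 * m) \<tau>"
    using S_complex_iff[of k m \<tau>] \<tau> k by auto
  have inj: "inj_on swap_pairs \<tau>"
    using bij_betw_swap_pairs[of m] sub by (meson bij_betw_imp_inj_on inj_on_subset)
  have "swap_pairs ` \<tau> \<subseteq> {1..2 * m}" using sub swap_pairs_range by blast
  then have "card ?\<sigma> = 2 * m - card (swap_pairs ` \<tau>)"
    using finite_subset by (subst card_Diff_subset) auto
  then have card': "card ?\<sigma> = 2 * (m - k)" using card card_image[OF inj] by simp
  have "bridged (2 * m) ?\<sigma>"
    unfolding bridged_def
  proof (intro ballI impI)
    fix e assume e: "e \<in> {1..2 * m}" "even e"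
    let ?o = "cyc_suc (2 * m) e"
    have o: "?o \<in> {1..2 * m}" "odd ?o" using cyc_suc_range cyc_suc_parity e by auto
    have o1: "?o + 1 \<in> {1..2 * m}" using o by (cases "?o = 2 * m") auto
    have e1: "e - 1 \<in> {1..2 * m}" "odd (e - 1)" using e by auto
    have "swap_pairs e = e - 1" "swap_pairs (e - 1) = e" "swap_pairs ?o = ?o + 1" "swap_pairs (?o + 1) = ?o"
      using e e1 o by (auto simp: swap_pairs_def)
    then have "e \<in> ?\<sigma> \<longleftrightarrow> e - 1 \<notin> \<tau>" "e - 1 \<in> ?\<sigma> \<longleftrightarrow> e \<notin> \<tau>"
      "?o \<in> ?\<sigma> \<longleftrightarrow> ?o + 1 \<notin> \<tau>" "?o + 1 \<in> ?\<sigma> \<longleftrightarrow> ?o \<notin> \<tau>"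
      using complement_swap_pairs_iff[OF sub e(1)] complement_swap_pairs_iff[OF sub e1(1)]
        complement_swap_pairs_iff[OF sub o(1)] complement_swap_pairs_iff[OF sub o1] by metis+
    then show "e \<in> ?\<sigma> \<and> e - 1 \<notin> ?\<sigma> \<longleftrightarrow> ?o \<in> ?\<sigma> \<and> ?o + 1 \<notin> ?\<sigma>"
      using br[unfolded bridged_def, rule_format, OF e] by blast
  qed
  then show ?thesis using S_complex_iff[of "m - k" m ?\<sigma>] card' k by auto
qed

theorem relabel_swap_pairs_S_complex:
  assumes k: "1 \<le> k" "k < m"
  shows "relabel swap_pairs (S_complex (2 * m) (2 * k - 1))
    = complement_complex (2 * m) (S_complex (2 * m) (2 * (m - k) - 1))"
proof (intro equalityI subsetI)
  fix \<rho> assume "\<rho> \<in> relabel swap_pairs (S_complex (2 * m) (2 * k - 1))"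
  then obtain \<tau> where \<tau>: "\<tau> \<in> S_complex (2 * m) (2 * k - 1)" "\<rho> = swap_pairs ` \<tau>"
    by (auto simp: relabel_def)
  have "\<tau> \<subseteq> {1..2 * m}" using S_complex_iff[of k m \<tau>] \<tau> k by auto
  then have "\<rho> \<subseteq> {1..2 * m}" using \<tau>(2) swap_pairs_range by blast
  then have "\<rho> = {1..2 * m} - ({1..2 * m} - \<rho>)" by blast
  then show "\<rho> \<in> complement_complex (2 * m) (S_complex (2 * m) (2 * (m - k) - 1))"
    using complement_swap_pairs_S_complex[OF k \<tau>(1)] \<tau>(2) by (auto simp: complement_complex_def)
next
  fix \<rho> assume "\<rho> \<in> complement_complex (2 * m) (S_complex (2 * m) (2 * (m - k) - 1))"
  then obtain \<sigma> where \<sigma>: "\<sigma> \<in> S_complex (2 * m) (2 * (m - k) - 1)" "\<rho> = {1..2 * m} - \<sigma>"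
    by (auto simp: complement_complex_def)
  define \<tau> where "\<tau> = {1..2 * m} - swap_pairs ` \<sigma>"
  have sub: "\<sigma> \<subseteq> {1..2 * m}" using S_complex_iff[of "m - k" m \<sigma>] \<sigma> k by auto
  \<comment> \<open>Swap and complement form an involution that exchanges \<open>k\<close> and
    \<open>m - k\<close>, so the same lemma yields the converse inclusion.\<close>
  have "\<tau> \<in> S_complex (2 * m) (2 * k - 1)"
    using complement_swap_pairs_S_complex[of "m - k" m \<sigma>] \<sigma>(1) k by (simp add: \<tau>_def)
  moreover have "swap_pairs ` \<tau> = \<rho>"
  proof (intro equalityI subsetI)
    fix x assume "x \<in> swap_pairs ` \<tau>"
    then obtain y where y: "y \<in> \<tau>" "x = swap_pairs y" by blast
    then show "x \<in> \<rho>" using complement_swap_pairs_iff[OF sub, of y] swap_pairs_range[of y m] \<sigma>(2)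
      by (auto simp: \<tau>_def)
  next
    fix x assume x: "x \<in> \<rho>"
    then have r: "x \<in> {1..2 * m}" "x \<notin> \<sigma>" using \<sigma>(2) by auto
    then have xx: "swap_pairs (swap_pairs x) = x" using swap_pairs_swap_pairs by simp
    then have "swap_pairs x \<in> \<tau>"
      using complement_swap_pairs_iff[OF sub swap_pairs_range[OF r(1)]] r(2) by (simp add: \<tau>_def)
    then show "x \<in> swap_pairs ` \<tau>" using xx by force
  qed
  ultimately show "\<rho> \<in> relabel swap_pairs (S_complex (2 * m) (2 * k - 1))"
    by (auto simp: relabel_def)
qed

section \<open>Alternating Vandermonde matrices\<close>

definition node_poly :: "nat set \<Rightarrow> real poly" where
  "node_poly B = (\<Prod>b\<in>B. [:- real b, 1:])"

lemma poly_node_poly: "poly (node_poly B) x = (\<Prod>b\<in>B. x - real b)"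
  by (simp add: node_poly_def poly_prod)

lemma poly_node_poly_eq_0_iff: "finite B \<Longrightarrow> poly (node_poly B) (real x) = 0 \<longleftrightarrow> x \<in> B"
  by (auto simp: poly_node_poly)

lemma degree_node_poly: "degree (node_poly B) = card B"
  unfolding node_poly_def by (subst degree_prod_sum_eq) auto

text \<open>The factors x - b and y - b differ in sign exactly when b lies between x and y.\<close>

lemma sgn_node_poly_mult:
  assumes "finite B" "x \<notin> B" "y \<notin> B" "x < y"
  shows "sgn (poly (node_poly B) (real x) * poly (node_poly B) (real y)) = (- 1) ^ card (B \<inter> {x<..<y})"
  using assms(1-3)
proof (induction B)
  case empty
  then show ?case by (simp add: node_poly_def)
next
  case (insert b B)
  have split: "poly (node_poly (insert b B)) z = (z - real b) * poly (node_poly B) z" for z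
    using insert.hyps by (simp add: poly_node_poly)
  have IH: "sgn (poly (node_poly B) (real x) * poly (node_poly B) (real y)) = (- 1) ^ card (B \<inter> {x<..<y})"
    using insert by simp
  have "sgn (poly (node_poly (insert b B)) (real x) * poly (node_poly (insert b B)) (real y))
      = sgn ((real x - real b) * (real y - real b)) *
        sgn (poly (node_poly B) (real x) * poly (node_poly B) (real y))"
    unfolding split by (simp add: sgn_mult mult_ac)
  also have "sgn ((real x - real b) * (real y - real b)) = (if b \<in> {x<..<y} then - 1 else 1)"
  proof -
    consider "b < x" | "x < b" "b < y" | "y < b" using insert.prems by force
    then show ?thesis using assms(4) by cases (simp_all add: sgn_mult)
  qed
  also have "\<dots> * sgn (poly (node_poly B) (real x) * poly (node_poly B) (real y))
      = (- 1) ^ card (insert b B \<inter> {x<..<y})"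
    unfolding IH using insert.hyps by (simp add: Int_insert_left)
  finally show ?case .
qed

text \<open>A linear dependence of the rows would be a nonzero polynomial of degree below d with d
  distinct roots; the nonzero column factors do not affect its roots.\<close>

lemma det_vandermonde_nonzero:
  fixes A :: "real mat"
  assumes A: "A \<in> carrier_mat d d"
    and entry: "\<And>r c. r < d \<Longrightarrow> c < d \<Longrightarrow> A $$ (r, c) = s c * x c ^ r"
    and s: "\<And>c. c < d \<Longrightarrow> s c \<noteq> 0" and inj: "inj_on x {..<d}"
  shows "Determinant.det A \<noteq> 0"
proof
  assume "Determinant.det A = 0"
  then have "Determinant.det (transpose_mat A) = 0" using det_transpose[OF A] by simp
  then obtain v where v: "v \<in> carrier_vec d" "v \<noteq> 0\<^sub>v d" "transpose_mat A *\<^sub>v v = 0\<^sub>v d"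
    using det_0_iff_vec_prod_zero[of "transpose_mat A" d] A by auto
  define p where "p = (\<Sum>r<d. monom (vec_index v r) r)"
  have root: "poly p (x c) = 0" if c: "c < d" for c
  proof -
    have "0 = vec_index (transpose_mat A *\<^sub>v v) c" using v(3) c by simp
    also have "\<dots> = (\<Sum>r<d. A $$ (r, c) * vec_index v r)"
      using A v(1) c by (simp add: scalar_prod_def atLeast0LessThan)
    also have "\<dots> = (\<Sum>r<d. s c * (vec_index v r * x c ^ r))"
      by (rule sum.cong) (use entry c in auto)
    also have "\<dots> = s c * poly p (x c)"
      by (simp add: p_def poly_sum poly_monom sum_distrib_left)
    finally show ?thesis using s[OF c] by simp
  qed
  have coeff: "coeff p r = vec_index v r" if "r < d" for r
    using that by (simp add: p_def coeff_sum)
  obtain r where r: "r < d" "vec_index v r \<noteq> 0" using v(1,2) by (metis carrier_vecD eq_vecI index_zero_vec)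
  then have nz: "p \<noteq> 0" using coeff by force
  have "degree p \<le> d - 1"
    unfolding p_def by (rule degree_sum_le) (auto intro: order_trans[OF degree_monom_le])
  then have "degree p < d" using r(1) by linarith
  moreover have "card (x ` {..<d}) \<le> card {z. poly p z = 0}"
    by (rule card_mono) (use poly_roots_finite[OF nz] root in auto)
  then have "d \<le> degree p" using card_poly_roots_bound[OF nz] inj by (simp add: card_image)
  ultimately show False by simp
qed

lemma pick_Compl_singleton: "pick (- {c}) j = (if j < c then j else Suc j)"
proof -
  define i where "i = (if j < c then j else Suc j)"
  have "{a \<in> - {c}. a < i} = {..<i} - {c}" by auto
  then have "card {a \<in> - {c}. a < i} = j" by (auto simp: i_def)
  then show ?thesis using pick_card_in_set[of i "- {c}"] by (simp add: i_def split: if_splits)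
qed

lemma
  assumes M: "M \<in> carrier_mat d (Suc d)" and c: "c < Suc d"
  shows submatrix_delete_carrier: "submatrix M UNIV (- {c}) \<in> carrier_mat d d"
    and submatrix_delete_index: "i < d \<Longrightarrow> j < d \<Longrightarrow>
      submatrix M UNIV (- {c}) $$ (i, j) = M $$ (i, if j < c then j else Suc j)"
proof -
  have "{j. j < Suc d \<and> j \<in> - {c}} = {..<Suc d} - {c}" by auto
  then have dims: "card {j. j < Suc d \<and> j \<in> - {c}} = d" "card {i. i < d \<and> i \<in> (UNIV :: nat set)} = d"
    using c by simp_all
  then show "submatrix M UNIV (- {c}) \<in> carrier_mat d d"
    using M by (intro carrier_matI) (simp_all add: dim_submatrix)
  show "submatrix M UNIV (- {c}) $$ (i, j) = M $$ (i, if j < c then j else Suc j)" if "i < d" "j < d"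
    using M that dims by (subst submatrix_index) (simp_all add: pick_UNIV pick_Compl_singleton)
qed

text \<open>The sum is the Laplace expansion of a determinant in which row \<open>r\<close> occurs twice.\<close>

lemma signed_minors_in_kernel:
  fixes M :: "real mat"
  assumes M: "M \<in> carrier_mat d (Suc d)" and r: "r < d"
  shows "(\<Sum>c<Suc d. M $$ (r, c) * ((- 1) ^ c * Determinant.det (submatrix M UNIV (- {c})))) = 0"
proof -
  define A where "A = mat (Suc d) (Suc d) (\<lambda>(i, c). if i = d then M $$ (r, c) else M $$ (i, c))"
  have A: "A \<in> carrier_mat (Suc d) (Suc d)" by (simp add: A_def)
  have del: "mat_delete A d c = submatrix M UNIV (- {c})" if c: "c < Suc d" for c
  proof (rule eq_matI)
    show "dim_row (mat_delete A d c) = dim_row (submatrix M UNIV (- {c}))"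
      "dim_col (mat_delete A d c) = dim_col (submatrix M UNIV (- {c}))"
      using submatrix_delete_carrier[OF M c] by (simp_all add: A_def)
    fix i j assume "i < dim_row (submatrix M UNIV (- {c}))" "j < dim_col (submatrix M UNIV (- {c}))"
    then have "i < d" "j < d" using submatrix_delete_carrier[OF M c] by auto
    then show "mat_delete A d c $$ (i, j) = submatrix M UNIV (- {c}) $$ (i, j)"
      using submatrix_delete_index[OF M c] c by (simp add: mat_delete_def A_def)
  qed
  have last: "A $$ (d, c) = M $$ (r, c)" if "c < Suc d" for c using that by (simp add: A_def)
  have "0 = Determinant.det A"
    by (rule det_identical_rows[OF A, of d r, symmetric])
       (use r in \<open>auto simp: A_def intro!: eq_vecI\<close>)
  also have "\<dots> = (\<Sum>c<Suc d. A $$ (d, c) * cofactor A d c)"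
    by (rule laplace_expansion_row[OF A]) simp
  also have "\<dots> = (\<Sum>c<Suc d. (- 1) ^ d * (M $$ (r, c) * ((- 1) ^ c * Determinant.det (submatrix M UNIV (- {c})))))"
    by (rule sum.cong) (auto simp: cofactor_def del last power_add)
  finally show ?thesis by (simp only: sum_distrib_left[symmetric]) simp
qed

text \<open>The signed maximal minors span the kernel of \<open>M\<close>. Pairing the kernel relation with the
  polynomial that vanishes at all nodes except two compares the signs of two coordinates.\<close>

lemma positively_spanning_vandermonde:
  assumes M: "M \<in> carrier_mat d (Suc d)"
    and entry: "\<And>r c. r < d \<Longrightarrow> c < Suc d \<Longrightarrow> M $$ (r, c) = s c * real (y c) ^ r"
    and s: "\<And>c. c < Suc d \<Longrightarrow> s c \<noteq> 0" and inj: "inj_on y {..<Suc d}"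
    and alt: "\<And>a b. a < Suc d \<Longrightarrow> b < Suc d \<Longrightarrow> a \<noteq> b \<Longrightarrow>
      s a * s b * (poly (node_poly (y ` {..<Suc d} - {y a, y b})) (real (y a)) *
        poly (node_poly (y ` {..<Suc d} - {y a, y b})) (real (y b))) < 0"
  shows "positively_spanning M"
proof -
  define w where "w c = (- 1) ^ c * Determinant.det (submatrix M UNIV (- {c}))" for c
  have w_nz: "w c \<noteq> 0" if c: "c < Suc d" for c
  proof -
    have "Determinant.det (submatrix M UNIV (- {c})) \<noteq> 0"
    proof (rule det_vandermonde_nonzero[OF submatrix_delete_carrier[OF M c]])
      define e where "e j = (if j < c then j else Suc j)" for j
      have e_lt: "e j < Suc d" if "j < d" for j using that by (simp add: e_def)
      have e_inj: "e i = e j \<Longrightarrow> i = j" for i j by (auto simp: e_def split: if_splits)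
      show "submatrix M UNIV (- {c}) $$ (r, j) = s (e j) * real (y (e j)) ^ r"
        if "r < d" "j < d" for r j
        unfolding submatrix_delete_index[OF M c that] e_def[symmetric] using that e_lt by (intro entry)
      show "s (e j) \<noteq> 0" if "j < d" for j using s[OF e_lt[OF that]] .
      show "inj_on (\<lambda>j. real (y (e j))) {..<d}"
      proof (rule inj_onI)
        fix i j assume ij: "i \<in> {..<d}" "j \<in> {..<d}" "real (y (e i)) = real (y (e j))"
        then have "e i = e j" using inj_onD[OF inj, of "e i" "e j"] e_lt by simp
        then show "i = j" by (rule e_inj)
      qed
    qed
    then show ?thesis by (simp add: w_def)
  qed
  \<comment> \<open>Combining the d rows with the coefficients of \<open>q\<close> turns the kernel
    relation into one between the values of \<open>q\<close> at the nodes.\<close>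
  have kernel: "(\<Sum>c<Suc d. poly q (real (y c)) * (s c * w c)) = 0" if q: "degree q < d" for q
  proof -
    have pq: "poly q z = (\<Sum>r<d. coeff q r * z ^ r)" for z
    proof -
      have "poly q z = (\<Sum>r\<le>degree q. coeff q r * z ^ r)" by (rule poly_altdef)
      also have "\<dots> = (\<Sum>r<d. coeff q r * z ^ r)"
        by (rule sum.mono_neutral_left) (use q in \<open>auto simp: coeff_eq_0\<close>)
      finally show ?thesis .
    qed
    have "(\<Sum>c<Suc d. poly q (real (y c)) * (s c * w c))
        = (\<Sum>c<Suc d. \<Sum>r<d. coeff q r * (M $$ (r, c) * w c))"
      unfolding pq sum_distrib_right by (intro sum.cong) (auto simp: entry)
    also have "\<dots> = (\<Sum>r<d. coeff q r * (\<Sum>c<Suc d. M $$ (r, c) * w c))"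
      by (subst sum.swap) (simp only: sum_distrib_left)
    also have "\<dots> = 0"
      using signed_minors_in_kernel[OF M] unfolding w_def by (intro sum.neutral) auto
    finally show ?thesis .
  qed
  have same_sign: "w a * w b > 0" if ab: "a < Suc d" "b < Suc d" "a \<noteq> b" for a b
  proof -
    \<comment> \<open>\<open>Y\<close> has d - 1 nodes, so the degree of \<open>q\<close> just stays
      in the range of \<open>kernel\<close>, and only two summands survive.\<close>
    define Y where "Y = y ` {..<Suc d} - {y a, y b}"
    define q where "q = node_poly Y"
    have yab: "y a \<noteq> y b" using inj ab by (auto dest: inj_onD)
    have "card Y = card (y ` {..<Suc d}) - card {y a, y b}"
      unfolding Y_def using ab by (intro card_Diff_subset) auto
    then have "card Y = d - 1" using card_image[OF inj] yab by simp
    moreover have "d > 0" using ab by auto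
    ultimately have "degree q < d" by (simp add: q_def degree_node_poly)
    then have "0 = (\<Sum>c<Suc d. poly q (real (y c)) * (s c * w c))" by (simp only: kernel)
    also have "\<dots> = (\<Sum>c\<in>{a, b}. poly q (real (y c)) * (s c * w c))"
    proof (rule sum.mono_neutral_right)
      show "\<forall>c\<in>{..<Suc d} - {a, b}. poly q (real (y c)) * (s c * w c) = 0"
      proof
        fix c assume c: "c \<in> {..<Suc d} - {a, b}"
        then have "y c \<in> Y" using ab by (auto simp: Y_def dest: inj_onD[OF inj])
        then have "poly q (real (y c)) = 0" by (simp add: q_def poly_node_poly_eq_0_iff Y_def)
        then show "poly q (real (y c)) * (s c * w c) = 0" by simp
      qed
    qed (use ab in auto)
    also have "\<dots> = poly q (real (y a)) * s a * w a + poly q (real (y b)) * s b * w b"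
      using ab(3) by simp
    finally have rel: "poly q (real (y a)) * s a * w a = - (poly q (real (y b)) * s b * w b)" by simp
    have neg: "s a * s b * (poly q (real (y a)) * poly q (real (y b))) < 0"
      using alt[OF ab] by (simp add: q_def Y_def)
    \<comment> \<open>The two surviving summands are opposite numbers, so their product is minus a
      square; the negative factor in \<open>neg\<close> then forces w a * w b > 0.\<close>
    have "s a * s b * (poly q (real (y a)) * poly q (real (y b))) * (w a * w b)
        = (poly q (real (y a)) * s a * w a) * (poly q (real (y b)) * s b * w b)" by simp
    also have "\<dots> = - (poly q (real (y b)) * s b * w b)\<^sup>2" unfolding rel by (simp add: power2_eq_square)
    also have "\<dots> < 0" using neg w_nz[OF ab(2)] by auto
    finally show ?thesis using neg by (simp add: mult_less_0_iff)
  qed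
  have all: "w c * w 0 > 0" if "c < Suc d" for c
    using same_sign[of c 0] w_nz[of 0] that by (cases "c = 0") (auto simp: zero_less_mult_iff linorder_neq_iff)
  \<comment> \<open>\<open>column_minor\<close> numbers columns from 1 and \<open>w\<close> from 0,
    which costs one sign: positive \<open>w\<close> leads to the negative alternative below.\<close>
  have minor: "(- 1) ^ i * column_minor M i = - w (i - 1)" if "i \<in> {1..Suc d}" for i
    using that by (cases i) (simp_all add: column_minor_def w_def)
  have "(\<forall>i\<in>{1..dim_col M}. (- 1) ^ i * column_minor M i > 0) \<or>
      (\<forall>i\<in>{1..dim_col M}. (- 1) ^ i * column_minor M i < 0)"
  proof (cases "w 0 > 0")
    case True
    then have "w c > 0" if "c < Suc d" for c using all[OF that] by (simp add: zero_less_mult_iff)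
    then have "\<forall>i\<in>{1..dim_col M}. (- 1) ^ i * column_minor M i < 0" using M minor by auto
    then show ?thesis by (rule disjI2)
  next
    case False
    then have "w c < 0" if "c < Suc d" for c using all[OF that] by (auto simp: zero_less_mult_iff)
    then have "\<forall>i\<in>{1..dim_col M}. (- 1) ^ i * column_minor M i > 0" using M minor by auto
    then show ?thesis by (rule disjI1)
  qed
  then show ?thesis using M by (auto simp: positively_spanning_def)
qed

section \<open>Decorating the complex\<close>

lemma nd_complex_S_complex:
  assumes "1 \<le> k" "2 \<le> m"
  shows "nd_complex (2 * m) (2 * k - 1) (S_complex (2 * m) (2 * k - 1))"
proof -
  have "S_complex (2 * m) (2 * k - 1) \<subseteq> Pow {1..2 * m}" using S_complex_iff[OF assms] by blast
  then have "finite (S_complex (2 * m) (2 * k - 1))" by (rule finite_subset) simp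
  then show ?thesis using S_complex_iff[OF assms] assms(1) by (simp add: nd_complex_def)
qed

lemma bij_betw_pick: "finite J \<Longrightarrow> bij_betw (pick J) {..<card J} J"
proof -
  assume J: "finite J"
  have inj: "inj_on (pick J) {..<card J}"
    by (rule linorder_inj_onI) (use pick_mono_le[of _ J] in \<open>force\<close>)+
  moreover have "pick J ` {..<card J} = J"
    by (rule card_subset_eq[OF J]) (use pick_in_set_le card_image[OF inj] in auto)
  ultimately show ?thesis by (simp add: bij_betw_def)
qed

theorem positively_decorable_S_complex:
  assumes k: "1 \<le> k" "k < m"
  shows "positively_decorable (2 * m) (2 * k - 1) (S_complex (2 * m) (2 * k - 1))"
proof -
  define n d where "n = 2 * m" and "d = 2 * k - 1"
  have m: "2 \<le> m" using k by simp
  \<comment> \<open>The column of vertex c + 1 is the moment curve vector at the swapped label, with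
    the sign given by the parity of that label.\<close>
  define C where "C = mat d n (\<lambda>(r, c). (- 1) ^ swap_pairs (c + 1) * real (swap_pairs (c + 1)) ^ r)"
  have "positively_spanning (submatrix C UNIV {j. j + 1 \<in> \<tau>})"
    if \<tau>: "\<tau> \<in> S_complex n d" for \<tau>
  proof -
    let ?J = "{j. j + 1 \<in> \<tau>}"
    let ?M = "submatrix C UNIV ?J"
    have sub: "\<tau> \<subseteq> {1..n}" and card\<tau>: "card \<tau> = Suc d"
      using S_complex_iff[OF k(1) m] \<tau> k by (auto simp: n_def d_def)
    have fin\<tau>: "finite \<tau>" using sub finite_subset by blast
    have Suc_J: "Suc ` ?J = \<tau>"
    proof (intro equalityI subsetI)
      fix x assume "x \<in> \<tau>"
      then show "x \<in> Suc ` ?J" using sub by (cases x) auto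
    qed auto
    have finJ: "finite ?J" using Suc_J fin\<tau> by (metis finite_imageD inj_Suc)
    have cardJ: "card ?J = Suc d" using card_image[of Suc ?J] Suc_J card\<tau> by simp
    have J_lt: "j < n" if "j \<in> ?J" for j using that sub by auto
    have "{j. j < n \<and> j \<in> ?J} = ?J" using J_lt by blast
    then have dims: "card {j. j < n \<and> j \<in> ?J} = Suc d" "card {i. i < d \<and> i \<in> (UNIV :: nat set)} = d"
      using cardJ by simp_all
    \<comment> \<open>The columns follow the order of \<tau>, whereas the swap reverses every block
      inside \<tau>. So \<open>y\<close> need not be increasing, and the criterion is applied
      through distinct nodes and pairwise signs only.\<close>
    define y where "y c = swap_pairs (pick ?J c + 1)" for c
    have bij: "bij_betw (pick ?J) {..<Suc d} ?J" using bij_betw_pick[OF finJ] cardJ by simp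
    have inj_swap: "inj_on swap_pairs \<tau>"
      using bij_betw_swap_pairs[of m] sub unfolding n_def by (meson bij_betw_imp_inj_on inj_on_subset)
    have inj: "inj_on y {..<Suc d}"
    proof (rule inj_onI)
      fix a b assume ab: "a \<in> {..<Suc d}" "b \<in> {..<Suc d}" "y a = y b"
      then have "pick ?J a \<in> ?J" "pick ?J b \<in> ?J" using bij by (auto simp: bij_betw_def)
      then have "pick ?J a + 1 = pick ?J b + 1"
        using ab(3) inj_onD[OF inj_swap] by (auto simp: y_def)
      then show "a = b" using bij ab by (auto simp: bij_betw_def dest: inj_onD)
    qed
    have img: "y ` {..<Suc d} = swap_pairs ` \<tau>"
    proof -
      have "y ` {..<Suc d} = swap_pairs ` Suc ` pick ?J ` {..<Suc d}" by (auto simp: y_def image_image)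
      then show ?thesis using bij Suc_J by (simp add: bij_betw_def)
    qed
    define T where "T = swap_pairs ` \<tau>"
    have T_sub: "T \<subseteq> {1..n}" using sub swap_pairs_range unfolding T_def n_def by blast
    have finT: "finite T" using fin\<tau> by (simp add: T_def)
    have comp: "{1..n} - T \<in> S_complex n (2 * (m - k) - 1)"
      using complement_swap_pairs_S_complex[OF k, of \<tau>] \<tau> by (simp add: n_def d_def T_def)
    \<comment> \<open>Of the b - a - 1 labels between a and b, an even number lies outside
      \<open>T\<close>, by evenness of the complement. So the node polynomial contributes b - a - 1
      signs modulo 2 and the columns contribute a + b; the total 2b - 1 is odd.\<close>
    have alternate: "(- 1 :: real) ^ a * (- 1) ^ b *
        (poly (node_poly (T - {a, b})) (real a) * poly (node_poly (T - {a, b})) (real b)) < 0"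
      if ab: "a \<in> T" "b \<in> T" "a < b" for a b
    proof -
      have "even (card (({1..n} - T) \<inter> {a<..<b}))"
        using comp k ab T_sub unfolding n_def by (intro S_complex_gale_evenness[of _ m "m - k"]) auto
      moreover have "card {a<..<b} = card (T \<inter> {a<..<b}) + card (({1..n} - T) \<inter> {a<..<b})"
      proof -
        have "{a<..<b} = T \<inter> {a<..<b} \<union> ({1..n} - T) \<inter> {a<..<b}" using ab T_sub by auto
        then show ?thesis using finT by (subst card_Un_disjoint[symmetric]) auto
      qed
      moreover have "card {a<..<b} = b - a - 1" by simp
      moreover have "(T - {a, b}) \<inter> {a<..<b} = T \<inter> {a<..<b}" by auto
      ultimately have "even (card ((T - {a, b}) \<inter> {a<..<b})) \<longleftrightarrow> even (b - a - 1)" by simp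
      moreover have "odd (a + b + (b - a - 1))" using ab(3) by presburger
      ultimately have odd: "odd (a + b + card ((T - {a, b}) \<inter> {a<..<b}))" by simp
      have "sgn ((- 1 :: real) ^ a * (- 1) ^ b *
          (poly (node_poly (T - {a, b})) (real a) * poly (node_poly (T - {a, b})) (real b)))
          = sgn ((- 1 :: real) ^ (a + b)) * (- 1) ^ card ((T - {a, b}) \<inter> {a<..<b})"
        unfolding sgn_mult[of "(- 1 :: real) ^ a * (- 1) ^ b"] power_add
        using finT ab(3) by (subst sgn_node_poly_mult) auto
      also have "\<dots> = (- 1) ^ (a + b + card ((T - {a, b}) \<inter> {a<..<b}))"
        by (cases "even (a + b)") (simp_all add: power_add[of _ "a + b"])
      also have "\<dots> = - 1" using odd by simp
      finally show ?thesis by (simp only: sgn_1_neg)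
    qed
    show ?thesis
    proof (rule positively_spanning_vandermonde[where d = d and y = y and s = "\<lambda>c. (- 1) ^ y c"])
      show "?M \<in> carrier_mat d (Suc d)"
        using dims by (intro carrier_matI) (simp_all add: dim_submatrix C_def)
      show "?M $$ (r, c) = (- 1) ^ y c * real (y c) ^ r" if rc: "r < d" "c < Suc d" for r c
      proof -
        have "pick ?J c \<in> ?J" using bij rc by (auto simp: bij_betw_def)
        then have "pick ?J c < n" by (rule J_lt)
        moreover have "?M $$ (r, c) = C $$ (r, pick ?J c)"
          using rc dims by (subst submatrix_index) (simp_all add: C_def pick_UNIV)
        ultimately show ?thesis using rc by (simp add: C_def y_def)
      qed
      show "inj_on y {..<Suc d}" by (rule inj)
      fix a b assume ab: "a < Suc d" "b < Suc d" "a \<noteq> b"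
      have yT: "y a \<in> T" "y b \<in> T" using img ab by (auto simp: T_def)
      have ne: "y a \<noteq> y b" using inj ab by (auto dest: inj_onD)
      show "(- 1 :: real) ^ y a * (- 1) ^ y b *
          (poly (node_poly (y ` {..<Suc d} - {y a, y b})) (real (y a)) *
           poly (node_poly (y ` {..<Suc d} - {y a, y b})) (real (y b))) < 0"
      proof (cases "y a < y b")
        case True
        then show ?thesis using alternate[OF yT] by (simp add: img T_def)
      next
        case False
        then have "y b < y a" using ne by simp
        then show ?thesis using alternate[OF yT(2,1)]
          by (simp add: img T_def mult.commute insert_commute)
      qed
    qed simp
  qed
  moreover have "C \<in> carrier_mat d n" by (simp add: C_def)
  ultimately show ?thesis
    unfolding positively_decorable_def using nd_complex_S_complex[OF k(1) m] by (auto simp: n_def d_def)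
qed

section \<open>Lower hulls of generic lifts\<close>

text \<open>\<open>generic\<close> bounds the lifted points on any hyperplane of the product space,
  vertical ones (b = 0) included. It makes all lower facets simplices and, with
  \<open>card_I\<close>, the lifted configuration full-dimensional.\<close>

locale generic_lift =
  fixes I :: "'i set" and p :: "'i \<Rightarrow> 'a::euclidean_space" and h :: "'i \<Rightarrow> real"
  assumes finite_I: "finite I"
    and card_I: "DIM('a) + 2 \<le> card I"
    and generic: "(a, b) \<noteq> (0, 0) \<Longrightarrow> card {i \<in> I. inner a (p i) + b * h i = c} \<le> DIM('a) + 1"
begin

text \<open>\<tau> is the entire contact set, so the affine function determines the facet; this
  later separates the affine pieces of the convex function.\<close>

definition supports :: "'a \<Rightarrow> real \<Rightarrow> 'i set \<Rightarrow> bool" where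
  "supports v c \<tau> \<longleftrightarrow>
     (\<forall>i\<in>I. inner v (p i) + c \<le> h i) \<and> \<tau> = {i \<in> I. inner v (p i) + c = h i}"

definition lower_facets :: "'i set set" where
  "lower_facets = {\<tau>. card \<tau> = DIM('a) + 1 \<and> (\<exists>v c. supports v c \<tau>)}"

lemma lower_facet_subset: "\<tau> \<in> lower_facets \<Longrightarrow> \<tau> \<subseteq> I"
  by (auto simp: lower_facets_def supports_def)

lemma finite_lower_facets: "finite lower_facets"
  by (rule finite_subset[of _ "Pow I"]) (use finite_I lower_facet_subset in auto)

text \<open>A hyperplane through the base points of a lower facet would span, together with the
  supporting hyperplane, a pencil having a member through one more lifted point.\<close>

lemma lower_facet_not_in_hyperplane:
  assumes \<tau>: "\<tau> \<in> lower_facets" and a: "a \<noteq> 0" and sub: "p ` \<tau> \<subseteq> {x. inner a x = c}"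
  shows False
proof -
  obtain v e where s: "supports v e \<tau>" and card\<tau>: "card \<tau> = DIM('a) + 1"
    using \<tau> by (auto simp: lower_facets_def)
  have fin: "finite \<tau>" using lower_facet_subset[OF \<tau>] finite_I finite_subset by blast
  have "\<not> I \<subseteq> \<tau>"
    using card_mono[OF fin, of I] card\<tau> card_I by auto
  then obtain j where j: "j \<in> I" "j \<notin> \<tau>" by blast
  define G where "G = h j - inner v (p j) - e"
  define A where "A = inner a (p j) - c"
  have G: "G \<noteq> 0" using s j by (auto simp: supports_def G_def)
  \<comment> \<open>\<open>A\<close> and \<open>G\<close> are the defects of the point
    \<open>j\<close> in the vertical and in the supporting hyperplane; in this member of the pencil
    they cancel as A G - G A.\<close>
  define w where "w = - (A *\<^sub>R v) - G *\<^sub>R a"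
  have nz: "(w, A) \<noteq> (0, 0)" using G a by (auto simp: w_def)
  have sub': "insert j \<tau> \<subseteq> {i \<in> I. inner w (p i) + A * h i = A * e - G * c}"
  proof
    fix i assume i: "i \<in> insert j \<tau>"
    show "i \<in> {i \<in> I. inner w (p i) + A * h i = A * e - G * c}"
    proof (cases "i = j")
      case True
      then show ?thesis using j
        by (simp add: w_def inner_diff_left G_def A_def algebra_simps)
    next
      case False
      then have "i \<in> \<tau>" using i by simp
      then have "inner a (p i) = c" "h i = inner v (p i) + e" "i \<in> I"
        using sub s by (auto simp: supports_def)
      then show ?thesis by (simp add: w_def inner_diff_left algebra_simps)
    qed
  qed
  have "card (insert j \<tau>) \<le> card {i \<in> I. inner w (p i) + A * h i = A * e - G * c}"
    by (rule card_mono[OF _ sub']) (use finite_I in simp)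
  also have "\<dots> \<le> DIM('a) + 1" by (rule generic[OF nz])
  finally have "card (insert j \<tau>) \<le> DIM('a) + 1" .
  then show False using fin j card\<tau> by simp
qed

lemma aff_dim_lower_facet:
  assumes "\<tau> \<in> lower_facets"
  shows "aff_dim (p ` \<tau>) = DIM('a)"
proof (rule ccontr)
  assume "aff_dim (p ` \<tau>) \<noteq> DIM('a)"
  then have "aff_dim (p ` \<tau>) < DIM('a)" using aff_dim_le_DIM[of "p ` \<tau>"] by linarith
  then obtain a c where "a \<noteq> 0" "p ` \<tau> \<subseteq> {x. inner a x = c}"
    using aff_lowdim_subset_hyperplane by blast
  then show False using lower_facet_not_in_hyperplane assms by blast
qed

lemma
  assumes \<tau>: "\<tau> \<in> lower_facets"
  shows inj_on_lower_facet: "inj_on p \<tau>"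
    and card_image_lower_facet: "card (p ` \<tau>) = DIM('a) + 1"
    and affine_independent_lower_facet: "\<not> affine_dependent (p ` \<tau>)"
proof -
  have fin: "finite \<tau>" using lower_facet_subset[OF \<tau>] finite_I finite_subset by blast
  have c: "card \<tau> = DIM('a) + 1" using \<tau> by (simp add: lower_facets_def)
  have "int (DIM('a)) \<le> int (card (p ` \<tau>)) - 1"
    using aff_dim_le_card[of "p ` \<tau>"] aff_dim_lower_facet[OF \<tau>] fin by simp
  moreover have "card (p ` \<tau>) \<le> card \<tau>" by (rule card_image_le[OF fin])
  ultimately show e: "card (p ` \<tau>) = DIM('a) + 1" using c by linarith
  then show "inj_on p \<tau>" using c fin by (simp add: eq_card_imp_inj_on)
  show "\<not> affine_dependent (p ` \<tau>)"
    unfolding affine_independent_iff_card using fin e aff_dim_lower_facet[OF \<tau>] by simp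
qed

text \<open>A lifted point on a lower facet is lowest over its base point. Two such points over one
  base point have equal height, so they share a facet, on which \<open>p\<close> is
  injective.\<close>

lemma inj_on_lower_facets: "inj_on p (\<Union>lower_facets)"
proof (rule inj_onI)
  have le: "h i \<le> h j" if "i \<in> \<tau>" "\<tau> \<in> lower_facets" "j \<in> I" "p i = p j" for i j \<tau>
    using that by (auto simp: lower_facets_def supports_def)
  fix i j assume ij: "i \<in> \<Union>lower_facets" "j \<in> \<Union>lower_facets" "p i = p j"
  then obtain \<tau> \<tau>' where t: "i \<in> \<tau>" "\<tau> \<in> lower_facets" "j \<in> \<tau>'" "\<tau>' \<in> lower_facets" by blast
  then have I: "i \<in> I" "j \<in> I" using lower_facet_subset by blast+
  have h: "h i = h j" using le[of i \<tau> j] le[of j \<tau>' i] t I ij(3) by simp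
  then have "j \<in> \<tau>" using t(1,2) I ij(3) by (auto simp: lower_facets_def supports_def)
  then show "i = j" using inj_on_lower_facet[OF t(2)] t(1) ij(3) by (auto dest: inj_onD)
qed

text \<open>At the vertices of \<tau> the function of \<tau> attains the heights, while that of
  \<tau>' stays at or below them; an affine inequality passes to the convex hull.\<close>

lemma supports_le:
  assumes s: "supports v c \<tau>" and s': "supports v' c' \<tau>'" and x: "x \<in> convex hull (p ` \<tau>)"
  shows "inner v' x + c' \<le> inner v x + c"
proof -
  have "p ` \<tau> \<subseteq> {x. inner (v' - v) x \<le> c - c'}"
    using s s' by (fastforce simp: supports_def inner_diff_left)
  then have "convex hull (p ` \<tau>) \<subseteq> {x. inner (v' - v) x \<le> c - c'}"
    by (simp add: hull_minimal convex_halfspace_le)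
  then show ?thesis using x by (auto simp: inner_diff_left)
qed

text \<open>By \<open>supports_le\<close>, agreement of the two functions cuts out a face of the
  simplex of \<tau>. Its vertices have heights on the function of \<tau>' too, hence belong to
  \<tau>'.\<close>

lemma supports_eq_imp:
  assumes s: "supports v c \<tau>" and s': "supports v' c' \<tau>'"
  defines "H \<equiv> {x. inner (v' - v) x = c - c'}"
  shows "convex hull (p ` \<tau>) \<inter> H face_of convex hull (p ` \<tau>)"
    and "convex hull (p ` \<tau>) \<inter> H \<subseteq> convex hull (p ` \<tau>')"
proof -
  show face: "convex hull (p ` \<tau>) \<inter> H face_of convex hull (p ` \<tau>)"
    unfolding H_def
    by (rule face_of_Int_supporting_hyperplane_le)
       (use supports_le[OF s s'] in \<open>auto simp: inner_diff_left algebra_simps\<close>)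
  have "finite \<tau>" using s finite_I by (auto simp: supports_def)
  then obtain Q where Q: "Q \<subseteq> p ` \<tau>" "convex hull (p ` \<tau>) \<inter> H = convex hull Q"
    using face_of_convex_hull_subset[OF _ face] finite_imp_compact by blast
  have "Q \<subseteq> p ` \<tau>'"
  proof
    fix x assume x: "x \<in> Q"
    then obtain i where i: "i \<in> \<tau>" "x = p i" using Q by blast
    have "x \<in> H" using Q(2) x hull_inc[of x Q convex] by blast
    then have "i \<in> \<tau>'" using i s s' by (auto simp: H_def supports_def inner_diff_left)
    then show "x \<in> p ` \<tau>'" using i by blast
  qed
  then show "convex hull (p ` \<tau>) \<inter> H \<subseteq> convex hull (p ` \<tau>')" using Q(2) hull_mono by metis
qed

text \<open>On common points \<open>supports_le\<close> applies in both directions, so the simplices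
  meet exactly where their affine functions agree.\<close>

lemma lower_facets_Int_face:
  assumes "\<tau> \<in> lower_facets" "\<tau>' \<in> lower_facets"
  shows "convex hull (p ` \<tau>) \<inter> convex hull (p ` \<tau>') face_of convex hull (p ` \<tau>)"
proof -
  obtain v c v' c' where s: "supports v c \<tau>" "supports v' c' \<tau>'"
    using assms by (auto simp: lower_facets_def)
  have "convex hull (p ` \<tau>) \<inter> convex hull (p ` \<tau>') \<subseteq> {x. inner (v' - v) x = c - c'}"
    using supports_le[OF s] supports_le[OF s(2,1)] by (force simp: inner_diff_left)
  then have "convex hull (p ` \<tau>) \<inter> convex hull (p ` \<tau>') =
      convex hull (p ` \<tau>) \<inter> {x. inner (v' - v) x = c - c'}"
    using supports_eq_imp(2)[OF s] by blast
  then show ?thesis using supports_eq_imp(1)[OF s] by simp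
qed

lemma aff_dim_lifted: "aff_dim ((\<lambda>i. (p i, h i)) ` I) = DIM('a) + 1"
proof (rule ccontr)
  assume "aff_dim ((\<lambda>i. (p i, h i)) ` I) \<noteq> DIM('a) + 1"
  then have "aff_dim ((\<lambda>i. (p i, h i)) ` I) < DIM('a \<times> real)"
    using aff_dim_le_DIM[of "(\<lambda>i. (p i, h i)) ` I"] by simp
  then obtain a c where a: "a \<noteq> 0" "(\<lambda>i. (p i, h i)) ` I \<subseteq> {x. inner a x = c}"
    using aff_lowdim_subset_hyperplane by blast
  obtain w b where ab: "a = (w, b)" by (cases a)
  have "I = {i \<in> I. inner w (p i) + b * h i = c}" using a(2) by (auto simp: ab)
  then have "card I \<le> DIM('a) + 1" using generic[of w b c] a(1) by (simp add: ab zero_prod_def)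
  then show False using card_I by simp
qed

text \<open>Over every point of the base the lowest point of the lifted polytope violates, when pushed
  down a little, some facet inequality; that facet is not vertical and contains the point.\<close>

lemma lower_facets_cover:
  assumes x: "x \<in> convex hull (p ` I)"
  shows "\<exists>\<tau>\<in>lower_facets. x \<in> convex hull (p ` \<tau>)"
proof -
  define L where "L = (\<lambda>i. (p i, h i)) ` I"
  define P where "P = convex hull L"
  have finL: "finite L" by (simp add: L_def finite_I)
  have fst_hull: "fst ` (convex hull ((\<lambda>i. (p i, h i)) ` J)) = convex hull (p ` J)" for J
    by (simp add: convex_hull_linear_image[OF linear_fst] image_image)
  have cP: "compact P" by (simp add: P_def finL finite_imp_compact compact_convex_hull)
  have "compact (P \<inter> {z. fst z = x})"
    by (intro compact_Int_closed cP closed_Collect_eq continuous_intros)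
  moreover have "P \<inter> {z. fst z = x} \<noteq> {}"
    using x fst_hull[of I] by (force simp: P_def L_def)
  ultimately obtain z0 where z0: "z0 \<in> P" "fst z0 = x"
    and z0min: "\<And>z. z \<in> P \<Longrightarrow> fst z = x \<Longrightarrow> snd z0 \<le> snd z"
    using continuous_attains_inf[of "P \<inter> {z. fst z = x}" snd] continuous_on_snd[OF continuous_on_id]
    by (metis (mono_tags, lifting) IntD1 IntD2 IntI mem_Collect_eq)
  define y where "y = snd z0"
  have z0eq: "z0 = (x, y)" using z0 by (simp add: y_def prod_eq_iff)
  have dimP: "aff_dim P = DIM('a) + 1"
    unfolding P_def aff_dim_convex_hull L_def by (rule aff_dim_lifted)
  then have affP: "affine hull P = UNIV" using aff_dim_eq_full[of P] by (simp add: add.commute)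
  have "polyhedron P" by (simp add: P_def finL polyhedron_convex_hull)
  then have "\<exists>F. finite F \<and> P = affine hull P \<inter> \<Inter>F \<and>
      (\<forall>H\<in>F. \<exists>a b. a \<noteq> 0 \<and> H = {x. inner a x \<le> b}) \<and>
      (\<forall>F'. F' \<subset> F \<longrightarrow> P \<subset> affine hull P \<inter> \<Inter>F')"
    by (rule iffD1[OF polyhedron_Int_affine_minimal])
  then obtain F where F: "finite F" "P = affine hull P \<inter> \<Inter>F"
    "\<And>F'. F' \<subset> F \<Longrightarrow> P \<subset> affine hull P \<inter> \<Inter>F'"
    and F_half: "\<forall>H\<in>F. \<exists>a b. a \<noteq> 0 \<and> H = {x. inner a x \<le> b}"
    by (elim exE conjE) blast
  from F_half obtain a b where ab: "\<And>H. H \<in> F \<Longrightarrow> a H \<noteq> 0 \<and> H = {x. inner (a H) x \<le> b H}"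
    by metis
  have PF: "P = \<Inter>F" using F(2) affP by simp
  have Pab: "z \<in> P \<longleftrightarrow> (\<forall>H\<in>F. inner (a H) z \<le> b H)" for z
    unfolding PF using ab by blast
  have "\<exists>H\<in>F. snd (a H) < 0 \<and> inner (a H) (x, y) = b H"
  proof (rule ccontr)
    assume none: "\<not> ?thesis"
    \<comment> \<open>Only inequalities in \<open>G\<close> can fail when the point moves down, and
      \<open>r H\<close> is the drop at which \<open>H\<close> becomes tight. The 1 keeps
      \<open>Min\<close> meaningful if \<open>G\<close> is empty.\<close>
    define G where "G = {H \<in> F. snd (a H) < 0}"
    define r where "r H = (b H - inner (a H) (x, y)) / (- snd (a H))" for H
    define \<epsilon> where "\<epsilon> = Min (insert 1 (r ` G))"
    have finG: "finite G" using F(1) by (simp add: G_def)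
    have "r H > 0" if "H \<in> G" for H
    proof -
      have "inner (a H) (x, y) \<le> b H" "inner (a H) (x, y) \<noteq> b H"
        using that none z0(1) Pab by (auto simp: G_def z0eq)
      then show ?thesis using that unfolding r_def G_def by (intro divide_pos_pos) auto
    qed
    then have eps: "\<epsilon> > 0" using finG by (simp add: \<epsilon>_def)
    have "(x, y - \<epsilon>) \<in> P"
      unfolding Pab
    proof
      fix H assume H: "H \<in> F"
      have le: "inner (a H) (x, y) \<le> b H" using z0(1) Pab H by (simp add: z0eq)
      have eq: "inner (a H) (x, y - \<epsilon>) = inner (a H) (x, y) - \<epsilon> * snd (a H)"
        by (cases "a H") (simp add: algebra_simps)
      show "inner (a H) (x, y - \<epsilon>) \<le> b H"
      proof (cases "H \<in> G")
        case True
        then have "\<epsilon> \<le> r H" "- snd (a H) > 0" using finG by (auto simp: \<epsilon>_def G_def)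
        then have "\<epsilon> * (- snd (a H)) \<le> b H - inner (a H) (x, y)"
          unfolding r_def by (metis pos_le_divide_eq)
        then show ?thesis using eq by linarith
      next
        case False
        then have "snd (a H) \<ge> 0" using H by (simp add: G_def)
        then have "\<epsilon> * snd (a H) \<ge> 0" using eps by simp
        then show ?thesis using eq le by linarith
      qed
    qed
    then show False using z0min[of "(x, y - \<epsilon>)"] eps by (simp add: y_def[symmetric])
  qed
  then obtain H where H: "H \<in> F" "snd (a H) < 0" "inner (a H) (x, y) = b H" by blast
  define \<tau> where "\<tau> = {i \<in> I. inner (a H) (p i, h i) = b H}"
  define C where "C = P \<inter> {z. inner (a H) z = b H}"
  \<comment> \<open>Minimality of the description makes each of its inequalities define a
    facet.\<close>
  have "C facet_of P"
    using facet_of_polyhedron_explicit[OF F(1,2) ab F(3)] H(1) C_def by blast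
  then have C: "C face_of P" "aff_dim C = DIM('a)" by (simp_all add: facet_of_def dimP)
  obtain Q where Q: "Q \<subseteq> L" "C = convex hull Q"
    using face_of_convex_hull_subset[of L C] C(1) finL finite_imp_compact P_def by blast
  have Q\<tau>: "Q \<subseteq> (\<lambda>i. (p i, h i)) ` \<tau>"
  proof
    fix z assume z: "z \<in> Q"
    have "z \<in> C" using z Q(2) hull_inc[of z Q convex] by blast
    then show "z \<in> (\<lambda>i. (p i, h i)) ` \<tau>" using z Q(1) by (auto simp: C_def L_def \<tau>_def)
  qed
  have "(x, y) \<in> C" using z0(1) H(3) by (simp add: C_def z0eq)
  then have "(x, y) \<in> convex hull ((\<lambda>i. (p i, h i)) ` \<tau>)" using Q(2) hull_mono[OF Q\<tau>] by blast
  then have "fst (x, y) \<in> fst ` (convex hull ((\<lambda>i. (p i, h i)) ` \<tau>))" by (rule imageI)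
  then have x\<tau>: "x \<in> convex hull (p ` \<tau>)" by (simp only: fst_hull fst_conv)
  obtain w e where we: "a H = (w, e)" by (cases "a H")
  have e: "e < 0" using H(2) we by simp
  have fin\<tau>: "finite \<tau>" using finite_I by (simp add: \<tau>_def)
  \<comment> \<open>The dimension of the facet forces at least DIM('a) + 1 lifted points on it, and
    genericity allows no more.\<close>
  have "int (DIM('a)) \<le> int (card Q) - 1"
    using aff_dim_le_card[of Q] C(2) finite_subset[OF Q(1) finL] by (simp add: Q(2) aff_dim_convex_hull)
  moreover have "card Q \<le> card \<tau>"
    using surj_card_le[OF fin\<tau> Q\<tau>] .
  moreover have "card \<tau> \<le> DIM('a) + 1"
    using generic[of w e "b H"] e by (simp add: \<tau>_def we)
  ultimately have "card \<tau> = DIM('a) + 1" by linarith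
  \<comment> \<open>The facet inequality solved for the height; division by the negative
    \<open>e\<close> turns it into a lower bound.\<close>
  moreover have "supports ((1 / (- e)) *\<^sub>R w) (b H / e) \<tau>"
  proof -
    have le: "inner w (p i) + e * h i \<le> b H" if "i \<in> I" for i
    proof -
      have "(p i, h i) \<in> P" using that by (simp add: P_def L_def hull_inc)
      then show ?thesis using Pab H(1) by (force simp: we)
    qed
    have eq: "inner ((1 / (- e)) *\<^sub>R w) (p i) + b H / e = h i - (b H - (inner w (p i) + e * h i)) / (- e)" for i
      using e by (simp add: field_simps)
    show ?thesis
      unfolding supports_def \<tau>_def eq
      using e le by (auto simp: we divide_nonneg_neg)
  qed
  ultimately have "\<tau> \<in> lower_facets" by (auto simp: lower_facets_def)
  then show ?thesis using x\<tau> by blast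
qed

section \<open>The regular triangulation formed by the lower facets\<close>

lemma lower_facets_nonempty: "lower_facets \<noteq> {}"
proof -
  obtain i where "i \<in> I" using card_I by fastforce
  then have "p i \<in> convex hull (p ` I)" by (simp add: hull_inc)
  then show ?thesis using lower_facets_cover by blast
qed

lemma vertices_of_lower_facet:
  "\<tau> \<in> lower_facets \<Longrightarrow> vertices_of (convex hull (p ` \<tau>)) = p ` \<tau>"
  by (simp add: vertices_of_def affine_independent_lower_facet extreme_point_of_convex_hull_affine_independent)

lemma aff_dim_base: "aff_dim (p ` I) = DIM('a)"
proof -
  obtain \<tau> where \<tau>: "\<tau> \<in> lower_facets" using lower_facets_nonempty by blast
  then have "aff_dim (p ` \<tau>) \<le> aff_dim (p ` I)"
    by (intro aff_dim_subset image_mono lower_facet_subset)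
  then show ?thesis using aff_dim_lower_facet[OF \<tau>] aff_dim_le_DIM[of "p ` I"] by linarith
qed

lemma triangulation_of_lower_facets:
  "triangulation_of (p ` I) ((\<lambda>\<tau>. convex hull (p ` \<tau>)) ` lower_facets)"
  unfolding triangulation_of_def
proof (intro conjI ballI)
  have simp: "int DIM('a) simplex convex hull (p ` \<tau>)" if "\<tau> \<in> lower_facets" for \<tau>
    unfolding simplex_def
    using affine_independent_lower_facet[OF that] card_image_lower_facet[OF that] by auto
  show "finite (p ` I)" using finite_I by simp
  show "triangulation ((\<lambda>\<tau>. convex hull (p ` \<tau>)) ` lower_facets)"
    unfolding triangulation_def
    using finite_lower_facets simp lower_facets_Int_face by (fastforce simp: Int_commute)
  show "\<Union> ((\<lambda>\<tau>. convex hull (p ` \<tau>)) ` lower_facets) = convex hull (p ` I)"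
  proof
    show "\<Union> ((\<lambda>\<tau>. convex hull (p ` \<tau>)) ` lower_facets) \<subseteq> convex hull (p ` I)"
      by (intro UN_least hull_mono image_mono lower_facet_subset)
    show "convex hull (p ` I) \<subseteq> \<Union> ((\<lambda>\<tau>. convex hull (p ` \<tau>)) ` lower_facets)"
      using lower_facets_cover by (intro subsetI) (simp only: UN_iff)
  qed
  fix \<sigma> assume "\<sigma> \<in> (\<lambda>\<tau>. convex hull (p ` \<tau>)) ` lower_facets"
  then obtain \<tau> where \<tau>: "\<tau> \<in> lower_facets" "\<sigma> = convex hull (p ` \<tau>)" by blast
  show "aff_dim (p ` I) simplex \<sigma>" using simp \<tau> aff_dim_base by simp
  show "vertices_of \<sigma> \<subseteq> p ` I" using \<tau> vertices_of_lower_facet image_mono[OF lower_facet_subset] by simp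
qed

text \<open>The base points of a lower facet affinely span the space, so an affine function is
  determined by its values there.\<close>

lemma affine_eq_on_lower_facet:
  assumes \<tau>: "\<tau> \<in> lower_facets" and g: "linear g"
    and eq: "\<And>x. x \<in> p ` \<tau> \<Longrightarrow> g x + e = inner v x + c"
  shows "g x + e = inner v x + c"
proof -
  have lin: "linear (\<lambda>x. g x - inner v x)"
    by (intro linear_compose_sub g bounded_linear.linear[OF bounded_linear_inner_right])
  have "affine {x. g x - inner v x = c - e}"
    unfolding affine_def
  proof (intro ballI allI impI)
    fix x y :: 'a and u w :: real
    assume xy: "x \<in> {x. g x - inner v x = c - e}" "y \<in> {x. g x - inner v x = c - e}" and uw: "u + w = 1"
    have "g (u *\<^sub>R x + w *\<^sub>R y) - inner v (u *\<^sub>R x + w *\<^sub>R y) = u * (g x - inner v x) + w * (g y - inner v y)"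
      using linear_add[OF lin, of "u *\<^sub>R x" "w *\<^sub>R y"] linear_scale[OF lin, of u x] linear_scale[OF lin, of w y]
      by simp
    also have "\<dots> = (u + w) * (c - e)" using xy by (simp add: distrib_right)
    finally show "u *\<^sub>R x + w *\<^sub>R y \<in> {x. g x - inner v x = c - e}" using uw by simp
  qed
  then have "affine hull (p ` \<tau>) \<subseteq> {x. g x - inner v x = c - e}"
    using eq by (intro hull_minimal) (auto simp: algebra_simps)
  moreover have "affine hull (p ` \<tau>) = UNIV"
    using aff_dim_lower_facet[OF \<tau>] by (simp add: aff_dim_eq_full)
  ultimately have "g x - inner v x = c - e" by blast
  then show ?thesis by simp
qed

text \<open>The witness is the maximum of all supporting functions: it is convex, and by
  \<open>supports_le\<close> it coincides on each simplex with the function of that simplex.\<close>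

theorem regular_triangulation_of_lower_facets:
  "regular_triangulation_of (p ` I) ((\<lambda>\<tau>. convex hull (p ` \<tau>)) ` lower_facets)"
proof -
  have "\<forall>\<tau>\<in>lower_facets. \<exists>vc. supports (fst vc) (snd vc) \<tau>"
    by (force simp: lower_facets_def)
  then obtain vc where vc: "\<And>\<tau>. \<tau> \<in> lower_facets \<Longrightarrow> supports (fst (vc \<tau>)) (snd (vc \<tau>)) \<tau>"
    by metis
  define g where "g \<tau> x = inner (fst (vc \<tau>)) x + snd (vc \<tau>)" for \<tau> x
  define f where "f x = Max ((\<lambda>\<tau>. g \<tau> x) ` lower_facets)" for x
  have g_le: "g \<tau> x \<le> f x" if "\<tau> \<in> lower_facets" for \<tau> x
    unfolding f_def using that finite_lower_facets by simp
  have f_ex: "\<exists>\<tau>\<in>lower_facets. f x = g \<tau> x" for x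
    using Max_in[of "(\<lambda>\<tau>. g \<tau> x) ` lower_facets"] finite_lower_facets lower_facets_nonempty
    unfolding f_def by blast
  have f_eq: "f x = g \<tau> x" if \<tau>: "\<tau> \<in> lower_facets" and x: "x \<in> convex hull (p ` \<tau>)" for \<tau> x
  proof -
    obtain \<tau>' where t: "\<tau>' \<in> lower_facets" "f x = g \<tau>' x" using f_ex by blast
    have "g \<tau>' x \<le> g \<tau> x"
      unfolding g_def using supports_le[OF vc[OF \<tau>] vc[OF t(1)] x] .
    then show ?thesis using g_le[OF \<tau>, of x] t(2) by simp
  qed
  have "convex_on (convex hull (p ` I)) f"
  proof (rule convex_onI)
    fix t :: real and x y :: 'a
    assume t: "0 < t" "t < 1"
    obtain \<tau> where \<tau>: "\<tau> \<in> lower_facets" "f ((1 - t) *\<^sub>R x + t *\<^sub>R y) = g \<tau> ((1 - t) *\<^sub>R x + t *\<^sub>R y)"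
      using f_ex by blast
    have "g \<tau> ((1 - t) *\<^sub>R x + t *\<^sub>R y) = (1 - t) * g \<tau> x + t * g \<tau> y"
      by (simp add: g_def inner_add_right algebra_simps)
    also have "\<dots> \<le> (1 - t) * f x + t * f y"
      using t g_le[OF \<tau>(1)] by (intro add_mono mult_left_mono) auto
    finally show "f ((1 - t) *\<^sub>R x + t *\<^sub>R y) \<le> (1 - t) * f x + t * f y" using \<tau>(2) by simp
  qed simp
  moreover have "affine_fun_on (convex hull (p ` \<tau>)) f" if "\<tau> \<in> lower_facets" for \<tau>
    unfolding affine_fun_on_def
    by (rule exI[of _ "inner (fst (vc \<tau>))"], rule exI[of _ "snd (vc \<tau>)"])
       (use f_eq[OF that] in \<open>auto simp: g_def bounded_linear.linear bounded_linear_inner_right\<close>)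
  moreover have "\<tau> = \<tau>'"
    if t: "\<tau> \<in> lower_facets" "\<tau>' \<in> lower_facets"
      and aff: "affine_fun_on (convex hull (p ` \<tau>) \<union> convex hull (p ` \<tau>')) f" for \<tau> \<tau>'
  proof -
    obtain q e where q: "linear q"
      "\<And>x. x \<in> convex hull (p ` \<tau>) \<union> convex hull (p ` \<tau>') \<Longrightarrow> f x = q x + e"
      using aff unfolding affine_fun_on_def by blast
    have "q x + e = inner (fst (vc \<tau>)) x + snd (vc \<tau>)" for x
      by (rule affine_eq_on_lower_facet[OF t(1) q(1)])
         (metis UnI1 f_eq g_def hull_inc q(2) t(1))
    moreover have "q x + e = inner (fst (vc \<tau>')) x + snd (vc \<tau>')" for x
      by (rule affine_eq_on_lower_facet[OF t(2) q(1)])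
         (metis UnI2 f_eq g_def hull_inc q(2) t(2))
    ultimately have "inner (fst (vc \<tau>)) x + snd (vc \<tau>) = inner (fst (vc \<tau>')) x + snd (vc \<tau>')" for x
      by metis
    \<comment> \<open>Equal supporting functions have equal contact sets.\<close>
    then show ?thesis using vc[OF t(1)] vc[OF t(2)] by (simp add: supports_def)
  qed
  ultimately have "convex_on (convex hull (p ` I)) f \<and>
      (\<forall>\<sigma>\<in>(\<lambda>\<tau>. convex hull (p ` \<tau>)) ` lower_facets. affine_fun_on \<sigma> f) \<and>
      (\<forall>\<sigma>\<in>(\<lambda>\<tau>. convex hull (p ` \<tau>)) ` lower_facets. \<forall>\<sigma>'\<in>(\<lambda>\<tau>. convex hull (p ` \<tau>)) ` lower_facets.
          \<sigma> \<noteq> \<sigma>' \<longrightarrow> \<not> affine_fun_on (\<sigma> \<union> \<sigma>') f)"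
    by fast
  then show ?thesis
    unfolding regular_triangulation_of_def by (intro conjI[OF triangulation_of_lower_facets] exI)
qed

end

section \<open>Projections of the moment curve\<close>

text \<open>The points are the images of the points \<open>i\<close> of the moment curve in \<open>\<real>\<^sup>d\<^sup>+\<^sup>1\<close> under the
  projective map that sends the hyperplane \<open>q = 0\<close> to infinity, followed by the projection along
  the image of the point represented by \<open>z\<close>, which lies on that hyperplane. A facet, given by a
  polynomial \<open>P\<close> that is nonnegative at the nodes, is then a lower one if and only if \<open>z P > 0\<close>.\<close>

theorem regular_complex_projected_moment_curve:
  fixes z :: "real poly \<Rightarrow> real" and q :: "real poly"
  assumes dim: "DIM('a::euclidean_space) = d" and n: "d + 2 \<le> n"
    and z_add: "\<And>f g. z (f + g) = z f + z g" and z_smult: "\<And>c f. z (smult c f) = c * z f"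
    and z1: "z 1 > 0"
    and q: "degree q = d + 1" "z q = 0" "\<And>i. i \<in> {1..n} \<Longrightarrow> poly q (real i) > 0"
    and \<Gamma>: "nd_complex n d \<Gamma>"
    and P: "\<And>\<tau>. \<tau> \<in> \<Gamma> \<Longrightarrow> \<exists>P. degree P \<le> d + 1 \<and> z P > 0 \<and>
      (\<forall>i\<in>{1..n}. poly P (real i) \<ge> 0 \<and> (poly P (real i) = 0 \<longleftrightarrow> i \<in> \<tau>))"
  shows "regular_complex TYPE('a) n \<Gamma>"
proof -
  obtain \<beta> where \<beta>: "bij_betw \<beta> {1..d} (Basis :: 'a set)"
    using ex_bij_betw_nat_finite_1[of "Basis :: 'a set"] dim by auto
  have inner_\<beta>: "inner (\<beta> i) (\<beta> j) = (if i = j then 1 else 0)" if "i \<in> {1..d}" "j \<in> {1..d}" for i j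
  proof -
    have "\<beta> i \<in> Basis" "\<beta> j \<in> Basis" using bij_betw_apply[OF \<beta>] that by simp_all
    moreover have "\<beta> i = \<beta> j \<longleftrightarrow> i = j"
      using inj_on_eq_iff[OF bij_betw_imp_inj_on[OF \<beta>] that] .
    ultimately show ?thesis by (simp add: inner_Basis)
  qed
  \<comment> \<open>The polynomials q, t^j - \<zeta> j for 1 <= j <= d, and 1 form a basis in degree
    at most d + 1, and \<open>z\<close> kills all but the last. Divided by q, they give the
    homogenizing 1, the base coordinates in \<open>p\<close>, and the height
    \<open>h\<close>.\<close>
  define \<zeta> where "\<zeta> j = z (monom 1 j) / z 1" for j
  define p :: "nat \<Rightarrow> 'a" where
    "p i = (\<Sum>j=1..d. ((real i ^ j - \<zeta> j) / poly q (real i)) *\<^sub>R \<beta> j)" for i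
  define h where "h i = 1 / poly q (real i)" for i
  have q_nz: "poly q (real i) \<noteq> 0" if "i \<in> {1..n}" for i using q(3)[OF that] by simp
  have inner_p: "inner v (p i) = (\<Sum>j=1..d. inner v (\<beta> j) * (real i ^ j - \<zeta> j)) / poly q (real i)" for v i
    unfolding p_def by (simp add: inner_sum_right sum_divide_distrib mult.commute)
  have coeff_q: "coeff q (d + 1) \<noteq> 0" using q(1) leading_coeff_0_iff[of q] by auto
  interpret generic_lift "{1..n}" p h
  proof
    show "finite {1..n}" by simp
    show "DIM('a) + 2 \<le> card {1..n}" using n dim by simp
    fix a :: 'a and b c :: real
    assume ab: "(a, b) \<noteq> (0, 0)"
    \<comment> \<open>The hyperplane equation multiplied by \<open>q\<close>. Being a nontrivial
      combination of the basis, \<open>R\<close> is nonzero and has at most d + 1 roots.\<close>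
    define R where "R = (\<Sum>j=1..d. smult (inner a (\<beta> j)) (monom 1 j - [:\<zeta> j:])) + [:b:] - smult c q"
    have poly_R: "poly R (real i) = (\<Sum>j=1..d. inner a (\<beta> j) * (real i ^ j - \<zeta> j)) + b - c * poly q (real i)" for i
      by (simp add: R_def poly_sum poly_monom)
    have coeff_R: "coeff R l = (if l \<in> {1..d} then inner a (\<beta> l) else 0) - c * coeff q l" if "l > 0" for l
    proof -
      have "coeff (smult (inner a (\<beta> j)) (monom 1 j - [:\<zeta> j:])) l = (if j = l then inner a (\<beta> l) else 0)" for j
        using that by (cases l) (simp_all add: coeff_diff)
      then show ?thesis using that
        by (cases l) (simp_all add: R_def coeff_sum)
    qed
    have "R \<noteq> 0"
    proof
      assume R0: "R = 0"
      have c0: "c = 0" using coeff_R[of "d + 1"] coeff_q by (simp add: R0)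
      have a0: "inner a (\<beta> j) = 0" if "j \<in> {1..d}" for j
        using coeff_R[of j] that c0 by (simp add: R0)
      have "inner a u = 0" if u: "u \<in> Basis" for u
      proof -
        obtain j where "j \<in> {1..d}" "u = \<beta> j" using bij_betw_imp_surj_on[OF \<beta>] u by (metis imageE)
        then show ?thesis using a0 by simp
      qed
      then have "a = 0" using euclidean_eqI[of a 0] by simp
      moreover have "b = 0" using poly_R[of 0] a0 c0 by (simp add: R0)
      ultimately show False using ab by simp
    qed
    have "degree R \<le> d + 1"
      by (rule degree_le) (use coeff_R q(1) in \<open>simp add: coeff_eq_0\<close>)
    have "{i \<in> {1..n}. inner a (p i) + b * h i = c} \<subseteq> {i \<in> {1..n}. poly R (real i) = 0}"
      unfolding poly_R inner_p h_def using q_nz by (auto simp: field_simps)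
    then have "real ` {i \<in> {1..n}. inner a (p i) + b * h i = c} \<subseteq> {x. poly R x = 0}" by blast
    then have "card (real ` {i \<in> {1..n}. inner a (p i) + b * h i = c}) \<le> card {x. poly R x = 0}"
      by (rule card_mono[OF poly_roots_finite[OF \<open>R \<noteq> 0\<close>]])
    also have "\<dots> \<le> d + 1" using card_poly_roots_bound[OF \<open>R \<noteq> 0\<close>] \<open>degree R \<le> d + 1\<close> by simp
    finally show "card {i \<in> {1..n}. inner a (p i) + b * h i = c} \<le> DIM('a) + 1"
      by (simp add: card_image dim)
  qed
  have z_sum: "z (\<Sum>j\<in>J. f j) = (\<Sum>j\<in>J. z (f j))" for J :: "nat set" and f
    using z_smult[of 0 0] by (induction J rule: infinite_finite_induct) (simp_all add: z_add)
  have lower: "\<tau> \<in> lower_facets" if \<tau>: "\<tau> \<in> \<Gamma>" for \<tau>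
  proof -
    obtain F where F: "degree F \<le> d + 1" "z F > 0"
      "\<And>i. i \<in> {1..n} \<Longrightarrow> poly F (real i) \<ge> 0"
      "\<And>i. i \<in> {1..n} \<Longrightarrow> poly F (real i) = 0 \<longleftrightarrow> i \<in> \<tau>"
      using P[OF \<tau>] by blast
    have sub: "\<tau> \<subseteq> {1..n}" and card\<tau>: "card \<tau> = d + 1" using \<Gamma> \<tau> by (auto simp: nd_complex_def)
    \<comment> \<open>The start of expanding \<open>F\<close> in that basis: \<alpha> is the
      coefficient of q, and applying \<open>z\<close> will identify the coefficient of 1 as \<kappa>
      = z F / z 1.\<close>
    define \<alpha> where "\<alpha> = coeff F (d + 1) / coeff q (d + 1)"
    define R where "R = F - smult \<alpha> q"
    have "coeff R l = 0" if "l > d" for l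
    proof (cases "l = d + 1")
      case True
      then show ?thesis using coeff_q by (simp add: R_def \<alpha>_def)
    next
      case False
      then show ?thesis using that F(1) q(1) by (simp add: R_def coeff_eq_0)
    qed
    then have deg: "degree R \<le> d" by (simp add: degree_le)
    have R_sum: "R = [:coeff R 0:] + (\<Sum>j=1..d. smult (coeff R j) (monom 1 j))"
    proof -
      have "R = (\<Sum>j\<le>d. monom (coeff R j) j)" using deg by (simp add: poly_as_sum_of_monoms')
      also have "\<dots> = monom (coeff R 0) 0 + (\<Sum>j=1..d. monom (coeff R j) j)"
        by (simp add: atMost_atLeast0 sum.atLeast_Suc_atMost)
      finally show ?thesis by (simp add: monom_0 smult_monom)
    qed
    define \<kappa> where "\<kappa> = z F / z 1"
    have \<kappa>_pos: "\<kappa> > 0" using F(2) z1 by (simp add: \<kappa>_def)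
    have "z F = z R"
    proof -
      have "F = R + smult \<alpha> q" by (simp add: R_def)
      then have "z F = z R + \<alpha> * z q" by (metis z_add z_smult)
      then show ?thesis using q(2) by simp
    qed
    also have "\<dots> = z (smult (coeff R 0) 1) + (\<Sum>j=1..d. coeff R j * z (monom 1 j))"
      by (subst R_sum) (simp add: z_add z_sum z_smult[symmetric])
    finally have \<kappa>: "\<kappa> = coeff R 0 + (\<Sum>j=1..d. coeff R j * \<zeta> j)"
      using z1 unfolding \<kappa>_def \<zeta>_def z_smult by (simp add: add_divide_distrib sum_divide_distrib)
    define v where "v = (\<Sum>j=1..d. coeff R j *\<^sub>R \<beta> j)"
    have inner_v: "inner v (\<beta> j) = coeff R j" if "j \<in> {1..d}" for j
    proof -
      have "inner v (\<beta> j) = (\<Sum>l=1..d. if l = j then coeff R l else 0)"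
        unfolding v_def inner_sum_left by (rule sum.cong) (use inner_\<beta> that in auto)
      then show ?thesis using that by simp
    qed
    have poly_R: "poly R (real i) = \<kappa> + (\<Sum>j=1..d. inner v (\<beta> j) * (real i ^ j - \<zeta> j))" for i
    proof -
      have "poly R (real i) = coeff R 0 + (\<Sum>j=1..d. coeff R j * real i ^ j)"
        by (subst R_sum) (simp add: poly_sum poly_monom)
      moreover have "(\<Sum>j=1..d. inner v (\<beta> j) * (real i ^ j - \<zeta> j))
          = (\<Sum>j=1..d. coeff R j * real i ^ j) - (\<Sum>j=1..d. coeff R j * \<zeta> j)"
        by (subst sum_subtractf[symmetric]) (rule sum.cong, auto simp: inner_v algebra_simps)
      ultimately show ?thesis using \<kappa> by simp
    qed
    \<comment> \<open>The expansion of \<open>F\<close> divided by \<kappa> q. Since \<kappa> > 0,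
      the last term is a nonnegative excess of the height over an affine function, vanishing exactly
      on \<tau>.\<close>
    have height: "h i = inner ((- 1 / \<kappa>) *\<^sub>R v) (p i) + (- \<alpha> / \<kappa>) + poly F (real i) / (\<kappa> * poly q (real i))"
      if "i \<in> {1..n}" for i
    proof -
      have "poly F (real i) = poly R (real i) + \<alpha> * poly q (real i)" by (simp add: R_def)
      also have "\<dots> = \<kappa> + inner v (p i) * poly q (real i) + \<alpha> * poly q (real i)"
        using q_nz[OF that] by (simp add: poly_R inner_p)
      finally show ?thesis using q_nz[OF that] \<kappa>_pos by (simp add: h_def field_simps)
    qed
    have le: "inner ((- 1 / \<kappa>) *\<^sub>R v) (p i) + (- \<alpha> / \<kappa>) \<le> h i" if "i \<in> {1..n}" for i
      unfolding height[OF that] using F(3)[OF that] q(3)[OF that] \<kappa>_pos by simp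
    have eq: "inner ((- 1 / \<kappa>) *\<^sub>R v) (p i) + (- \<alpha> / \<kappa>) = h i \<longleftrightarrow> i \<in> \<tau>" if "i \<in> {1..n}" for i
      using height[OF that] F(4)[OF that] q_nz[OF that] \<kappa>_pos by simp
    have "supports ((- 1 / \<kappa>) *\<^sub>R v) (- \<alpha> / \<kappa>) \<tau>"
      unfolding supports_def using le eq sub by blast
    then show ?thesis unfolding lower_facets_def using card\<tau>[folded dim] by blast
  qed
  have "inj_on p (\<Union>\<Gamma>)" by (rule inj_on_subset[OF inj_on_lower_facets]) (use lower in auto)
  moreover have "relabel p \<Gamma> \<subseteq> vertices_of ` (\<lambda>\<tau>. convex hull (p ` \<tau>)) ` lower_facets"
    unfolding relabel_def
  proof
    fix x assume "x \<in> (\<lambda>\<tau>. p ` \<tau>) ` \<Gamma>"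
    then obtain \<tau> where \<tau>: "\<tau> \<in> \<Gamma>" "x = p ` \<tau>" by blast
    then have "x = vertices_of (convex hull (p ` \<tau>))" using vertices_of_lower_facet[OF lower] by simp
    then show "x \<in> vertices_of ` (\<lambda>\<tau>. convex hull (p ` \<tau>)) ` lower_facets" using lower[OF \<tau>(1)] by blast
  qed
  ultimately show ?thesis
    unfolding regular_complex_def using \<Gamma> dim regular_triangulation_of_lower_facets by blast
qed

text \<open>Evenness gives the node polynomial the same sign at all nodes outside \<open>B\<close>,
  so multiplying by its value at one of them makes it positive there. Thus Gale's condition yields a
  supporting hyperplane of the moment curve.\<close>

lemma node_poly_sign:
  assumes B: "finite B"
    and even: "\<And>a b. a \<in> {1..n} - B \<Longrightarrow> b \<in> {1..n} - B \<Longrightarrow> even (card (B \<inter> {a<..<b}))"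
  obtains s where "s \<noteq> 0" "\<And>i. i \<in> {1..n} - B \<Longrightarrow> s * poly (node_poly B) (real i) > 0"
proof (cases "{1..n} - B = {}")
  case True
  then show ?thesis using that[of 1] by (metis empty_iff zero_neq_one)
next
  case False
  then obtain i0 where i0: "i0 \<in> {1..n} - B" by blast
  have nz: "poly (node_poly B) (real i) \<noteq> 0" if "i \<in> {1..n} - B" for i
    using that B by (simp add: poly_node_poly_eq_0_iff)
  have pos: "poly (node_poly B) (real a) * poly (node_poly B) (real b) > 0"
    if "a \<in> {1..n} - B" "b \<in> {1..n} - B" "a < b" for a b
    using sgn_node_poly_mult[OF B, of a b] even[of a b] that by (simp add: sgn_1_pos)
  show ?thesis
  proof (rule that)
    show "poly (node_poly B) (real i0) \<noteq> 0" using nz[OF i0] .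
    show "poly (node_poly B) (real i0) * poly (node_poly B) (real i) > 0" if i: "i \<in> {1..n} - B" for i
      using pos[OF i0 i] pos[OF i i0] nz[OF i] i0
      by (cases i i0 rule: linorder_cases) (auto simp: mult.commute zero_less_mult_iff linorder_neq_iff)
  qed
qed

text \<open>For small \<open>\<epsilon>\<close> the functional \<open>z\<close> represents a point just beyond the facet \<open>F = {2..2k+1}\<close> of the
  cyclic polytope, so that the projection is a Schlegel diagram. The facet \<open>F\<close> is not in the
  complex: it consists of \<open>k \<ge> 2\<close> adjacent dominoes, all starting at even vertices.\<close>

theorem regular_complex_S_complex:
  assumes k: "2 \<le> k" "k < m" and dim: "DIM('a::euclidean_space) = 2 * k - 1"
  shows "regular_complex TYPE('a) (2 * m) (S_complex (2 * m) (2 * k - 1))"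
proof -
  define n d \<Gamma> where "n = 2 * m" and "d = 2 * k - 1" and "\<Gamma> = S_complex (2 * m) (2 * k - 1)"
  have k1: "1 \<le> k" and m: "2 \<le> m" and d: "2 * k = d + 1" using k by (auto simp: d_def)
  have \<Gamma>_iff: "\<tau> \<in> \<Gamma> \<longleftrightarrow> \<tau> \<subseteq> {1..n} \<and> card \<tau> = 2 * k \<and> bridged n \<tau>" for \<tau>
    unfolding \<Gamma>_def n_def by (rule S_complex_iff[OF k1 m])
  have nd: "nd_complex n d \<Gamma>"
    using nd_complex_S_complex[OF k1 m] by (simp add: n_def d_def \<Gamma>_def)
  define F where "F = {2..2 * k + 1}"
  have F_sub: "F \<subseteq> {1..n}" using k by (auto simp: F_def n_def)
  \<comment> \<open>Block {1, 2} meets \<open>F\<close> in 2 alone, but block {3, 4} lies inside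
    \<open>F\<close> once k >= 2. For k = 1 the set {2, 3} would be a facet.\<close>
  have F_notin: "F \<notin> \<Gamma>"
  proof
    assume "F \<in> \<Gamma>"
    then have "bridged n F" by (simp add: \<Gamma>_iff)
    then have "2 \<in> F \<and> 2 - 1 \<notin> F \<longleftrightarrow> cyc_suc n 2 \<in> F \<and> cyc_suc n 2 + 1 \<notin> F"
      using k unfolding bridged_def n_def by (auto dest!: bspec[of _ _ 2])
    moreover have "cyc_suc n 2 = 3" using k by (simp add: cyc_suc_def n_def)
    ultimately show False using k by (simp add: F_def)
  qed
  have "\<exists>Q. degree Q = card \<tau> \<and> (\<forall>i\<in>{1..n}. poly Q (real i) \<ge> 0 \<and> (poly Q (real i) = 0 \<longleftrightarrow> i \<in> \<tau>))"
    if \<tau>: "\<tau> \<in> insert F \<Gamma>" for \<tau>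
  proof -
    have fin: "finite \<tau>" using \<tau> F_sub by (auto simp: \<Gamma>_iff intro: finite_subset)
    have "even (card (\<tau> \<inter> {a<..<b}))" if "a \<in> {1..n} - \<tau>" "b \<in> {1..n} - \<tau>" for a b
    proof (cases "\<tau> = F")
      case True
      \<comment> \<open>\<open>F\<close> is an interval with 2k elements, so two missing vertices
        have all of it between them or nothing.\<close>
      then have "\<tau> \<inter> {a<..<b} = {} \<or> \<tau> \<inter> {a<..<b} = {2..2 * k + 1}"
        using that by (auto simp: F_def)
      then show ?thesis by auto
    next
      case False
      then show ?thesis
        using S_complex_gale_evenness[of \<tau> m k a b] \<tau> that k1 m by (simp add: \<Gamma>_def n_def)
    qed
    then obtain s where s: "s \<noteq> 0" "\<And>i. i \<in> {1..n} - \<tau> \<Longrightarrow> s * poly (node_poly \<tau>) (real i) > 0"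
      using node_poly_sign[OF fin] by metis
    have val: "poly (smult s (node_poly \<tau>)) (real i) \<ge> 0 \<and>
        (poly (smult s (node_poly \<tau>)) (real i) = 0 \<longleftrightarrow> i \<in> \<tau>)" if "i \<in> {1..n}" for i
    proof (cases "i \<in> \<tau>")
      case True
      then have "poly (node_poly \<tau>) (real i) = 0" using fin by (simp add: poly_node_poly_eq_0_iff)
      then show ?thesis using True by simp
    next
      case False
      then show ?thesis using s(2)[of i] that by force
    qed
    show ?thesis
      by (rule exI[of _ "smult s (node_poly \<tau>)"]) (use s(1) val in \<open>simp add: degree_node_poly\<close>)
  qed
  then obtain Q where Q: "\<And>\<tau>. \<tau> \<in> insert F \<Gamma> \<Longrightarrow> degree (Q \<tau>) = card \<tau>"
    "\<And>\<tau> i. \<tau> \<in> insert F \<Gamma> \<Longrightarrow> i \<in> {1..n} \<Longrightarrow> poly (Q \<tau>) (real i) \<ge> 0"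
    "\<And>\<tau> i. \<tau> \<in> insert F \<Gamma> \<Longrightarrow> i \<in> {1..n} \<Longrightarrow> poly (Q \<tau>) (real i) = 0 \<longleftrightarrow> i \<in> \<tau>"
    by metis
  \<comment> \<open>Up to scaling, \<open>A\<close> and \<open>B\<close> are the barycentres of
    \<open>F\<close> and of all vertices. Subtracting a small multiple of \<open>B\<close> moves
    from \<open>F\<close> away from the interior: \<open>A\<close> vanishes on \<open>Q F\<close>
    and \<open>B\<close> does not, so only the inequality of \<open>F\<close> is violated.\<close>
  define A B where "A f = (\<Sum>i\<in>F. poly f (real i))" and "B f = (\<Sum>i=1..n. poly f (real i))" for f :: "real poly"
  have finF: "finite F" by (simp add: F_def)
  \<comment> \<open>Facets in \<Gamma> have the size of \<open>F\<close> but differ from it, so each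
    misses a vertex of \<open>F\<close>. Including the polynomial 1 lets the same \<epsilon> ensure
    z 1 > 0.\<close>
  have A_pos: "A f > 0" if f: "f \<in> insert 1 (Q ` \<Gamma>)" for f
  proof (cases "f = 1")
    case True
    then show ?thesis using k by (simp add: A_def F_def)
  next
    case False
    then obtain \<tau> where \<tau>: "\<tau> \<in> \<Gamma>" "f = Q \<tau>" using f by blast
    have "\<not> F \<subseteq> \<tau>"
    proof
      assume "F \<subseteq> \<tau>"
      moreover have "card F = card \<tau>" "finite \<tau>"
        using \<tau>(1) by (auto simp: F_def \<Gamma>_iff intro: finite_subset)
      ultimately have "F = \<tau>" by (simp add: card_subset_eq)
      then show False using \<tau>(1) F_notin by simp
    qed
    then obtain i where i: "i \<in> F" "i \<notin> \<tau>" by blast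
    then have "poly f (real i) > 0"
      using Q(2,3)[of \<tau> i] \<tau> F_sub by (force simp: less_le)
    then show ?thesis
      unfolding A_def using i(1) Q(2)[of \<tau>] \<tau> F_sub finF by (intro sum_pos2[of F i]) auto
  qed
  have fin\<Gamma>: "finite \<Gamma>" using nd by (simp add: nd_complex_def)
  have "\<forall>\<^sub>F \<epsilon> in at_right 0. \<forall>f\<in>insert 1 (Q ` \<Gamma>). \<epsilon> * B f < A f"
  proof (rule eventually_ball_finite)
    show "finite (insert 1 (Q ` \<Gamma>))" using fin\<Gamma> by simp
    show "\<forall>f\<in>insert 1 (Q ` \<Gamma>). \<forall>\<^sub>F \<epsilon> in at_right 0. \<epsilon> * B f < A f"
    proof
      fix f assume "f \<in> insert 1 (Q ` \<Gamma>)"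
      then have "0 < A f" by (rule A_pos)
      moreover have "((\<lambda>\<epsilon>. \<epsilon> * B f) \<longlongrightarrow> 0) (at_right 0)" by (auto intro!: tendsto_eq_intros)
      ultimately show "\<forall>\<^sub>F \<epsilon> in at_right 0. \<epsilon> * B f < A f" by (rule order_tendstoD(2)[rotated])
    qed
  qed
  then have "\<forall>\<^sub>F \<epsilon> in at_right (0 :: real). 0 < \<epsilon> \<and> (\<forall>f\<in>insert 1 (Q ` \<Gamma>). \<epsilon> * B f < A f)"
    using eventually_at_right_less[of "0 :: real"] by (rule eventually_conj[rotated])
  then have "\<exists>\<epsilon>::real. 0 < \<epsilon> \<and> (\<forall>f\<in>insert 1 (Q ` \<Gamma>). \<epsilon> * B f < A f)"
    by (rule eventually_happens'[OF trivial_limit_at_right_real])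
  then obtain \<epsilon> :: real where \<epsilon>: "0 < \<epsilon>" "\<And>f. f \<in> insert 1 (Q ` \<Gamma>) \<Longrightarrow> \<epsilon> * B f < A f"
    by blast
  define z where "z f = A f - \<epsilon> * B f" for f
  have z_add: "z (f + g) = z f + z g" for f g
    by (simp add: z_def A_def B_def sum.distrib algebra_simps)
  have z_smult: "z (smult c f) = c * z f" for c f
    by (simp add: z_def A_def B_def sum_distrib_left[symmetric] algebra_simps)
  have z1: "z 1 > 0" using \<epsilon>(2)[of 1] by (simp add: z_def)
  have "A (Q F) = 0" unfolding A_def using Q(3)[of F] F_sub by (intro sum.neutral) auto
  moreover have "B (Q F) > 0"
    unfolding B_def
  proof (rule sum_pos2[of _ 1])
    show "0 < poly (Q F) (real 1)"
      using Q(2,3)[of F 1] k by (force simp: less_le F_def n_def)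
  qed (use Q(2)[of F] k in \<open>auto simp: n_def\<close>)
  ultimately have zF: "z (Q F) < 0" using \<epsilon>(1) by (simp add: z_def)
  \<comment> \<open>Chosen so that z q = 0. As \<open>z\<close> is negative on \<open>Q F\<close>,
    the shift is upward: the hyperplane q = 0 passes through the point \<open>z\<close> and leaves
    all vertices strictly on one side.\<close>
  define \<delta> where "\<delta> = - z (Q F) / z 1"
  have \<delta>: "\<delta> > 0" using zF z1 by (simp add: \<delta>_def divide_neg_pos)
  define q where "q = Q F + smult \<delta> 1"
  have "regular_complex TYPE('a) n \<Gamma>"
  proof (rule regular_complex_projected_moment_curve[where z = z and q = q])
    show "DIM('a) = d" using dim by (simp add: d_def)
    show "d + 2 \<le> n" using k by (simp add: d_def n_def)
    have "degree (Q F) = d + 1" using Q(1)[of F] k by (simp add: F_def d_def)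
    then show "degree q = d + 1" unfolding q_def by (subst degree_add_eq_left) auto
    show "z q = 0" unfolding q_def z_add z_smult using z1 by (simp add: \<delta>_def)
    show "poly q (real i) > 0" if "i \<in> {1..n}" for i
      using Q(2)[of F i] that \<delta> by (simp add: q_def)
    show "\<exists>P. degree P \<le> d + 1 \<and> z P > 0 \<and>
        (\<forall>i\<in>{1..n}. poly P (real i) \<ge> 0 \<and> (poly P (real i) = 0 \<longleftrightarrow> i \<in> \<tau>))" if "\<tau> \<in> \<Gamma>" for \<tau>
    proof (intro exI[of _ "Q \<tau>"] conjI ballI)
      show "degree (Q \<tau>) \<le> d + 1" using Q(1)[of \<tau>] that \<Gamma>_iff d by simp
      show "z (Q \<tau>) > 0" using \<epsilon>(2)[of "Q \<tau>"] that by (simp add: z_def)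
    qed (use Q(2,3) that in auto)
  qed (fact z_add z_smult z1 nd)+
  then show ?thesis by (simp add: n_def \<Gamma>_def)
qed

theorem theorem6p8:
  fixes m k :: nat
  assumes "1 \<le> k" and "k \<le> m - 1"
  shows "relabel swap_pairs (S_complex (2 * m) (2 * k - 1))
           = complement_complex (2 * m) (S_complex (2 * m) (2 * m - 2 * k - 1))
         \<and> positively_decorable (2 * m) (2 * k - 1) (S_complex (2 * m) (2 * k - 1))
         \<and> (k \<ge> 2 \<and> DIM('a::euclidean_space) = 2 * k - 1 \<longrightarrow>
              regular_complex TYPE('a) (2 * m) (S_complex (2 * m) (2 * k - 1)))"
proof -
  have km: "k < m" using assms by simp
  have "2 * m - 2 * k - 1 = 2 * (m - k) - 1" by simp
  then show ?thesis
    using relabel_swap_pairs_S_complex[OF assms(1) km] positively_decorable_S_complex[OF assms(1) km]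
      regular_complex_S_complex[OF _ km, where 'a = 'a] by simp
qed

end
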